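(* Let $n\ge 3$ be odd, let $0<\rho<1/3$, and let $\Lambda\subset[0,1]^n$ be any finite nonempty set with cardinality $\nu$. In the heteroscedastic regression model $y_j=S(x_j)+\sigma_j(S)\xi_j$, $1\le j\le n$, described in the context, let $\widehat\varsigma_n$ be any estimator of $\varsigma_n=n^{-1}\sum_{l=1}^n\sigma_l^2(S)$, and let $\widehat S_*=\widehat S_{\widehat\lambda}$ be the procedure in which $\widehat\lambda$ minimizes over $\Lambda$ the penalized cost function $J_n$ built with $\rho$ and $\widehat\varsigma_n$. Then $$ \mathbf E_S\|\widehat S_*-S\|_n^2\le(1+\kappa(\rho))\min_{\lambda\in\Lambda}\mathbf E_S\|\widehat S_\lambda-S\|_n^2+\frac1n\,\mathcal B_n(\rho), $$ where $\mathcal B_n(\rho)=\Psi_n(\rho)+\kappa_*(\rho)\,\varrho_n\,\mathbf E_S|\widehat\varsigma_n-\varsigma_n|$ with $$ \kappa(\rho)=\frac{6\rho-2\rho^2}{1-3\rho},\qquad \kappa_*(\rho)=\frac{4(1-\rho^2)}{1-3\rho}. $$ If the volatility coefficients $(\sigma_l(S))_{1\le l\le n}$ are known, then one takes $\widehat\varsigma_n=\varsigma_n$ and the inequality has the form $$ \mathbf E_S\|\widehat S_*-S\|_n^2\le(1+\kappa(\rho))\min_{\lambda\in\Lambda}\mathbf E_S\|\widehat S_\lambda-S\|_n^2+\frac1n\,\Psi_n(\rho). $$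
   Context: Model. $n$ is odd, $x_j=j/n$, $S$ is an unknown real function, and one observes $y_j=S(x_j)+\sigma_j(S)\xi_j$, $1\le j\le n$. The $(\xi_j)_{1\le j\le n}$ are i.i.d. with $\mathbf E\xi_1=0$, $\mathbf E\xi_1^2=1$, $\mathbf E\xi_1^4=\xi^*<\infty$; put $\overline\xi=\sqrt{\xi^*-1}$. The $(\sigma_l(S))_{1\le l\le n}$ are positive random variables independent of $(\xi_i)_{1\le i\le n}$, and there is a nonrandom constant $\sigma_*\ge1$ with $\max_{1\le l\le n}\sigma_l^2(S)\le\sigma_*$. $\mathbf E_S$ is expectation when the regression function is $S$. Inner product and basis. $(f,g)_n=\frac1n\sum_{l=1}^n f(x_l)g(x_l)$, $\|f\|_n^2=(f,f)_n$. The trigonometric basis is $\phi_1=1$ and, for $j\ge2$, $\phi_j(x)=\sqrt2\cos(2\pi[j/2]x)$ for even $j$, $\phi_j(x)=\sqrt2\sin(2\pi[j/2]x)$ for odd $j$, where $[\cdot]$ is the integer part. Put $\overline\phi_j=\phi_j^2-1$. Estimators. $\widehat\theta_{j,n}=\frac1n\sum_{l=1}^n y_l\phi_j(x_l)$. For $\lambda=(\lambda(1),\dots,\lambda(n))\in\Lambda$, $\widehat S_\lambda=\sum_{j=1}^n\lambda(j)\widehat\theta_{j,n}\phi_j$. Further, $\varsigma_n=\frac1n\sum_{l=1}^n\sigma_l^2(S)$, $\widehat\varsigma_n$ is an estimator of $\varsigma_n$, $\widetilde\theta_{j,n}=\widehat\theta_{j,n}^2-\frac1n\widehat\varsigma_n$,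 $|\lambda|^2=\sum_{j=1}^n\lambda^2(j)$, $\widehat P_n(\lambda)=|\lambda|^2\widehat\varsigma_n/n$, and $$J_n(\lambda)=\sum_{j=1}^n\lambda^2(j)\widehat\theta_{j,n}^2-2\sum_{j=1}^n\lambda(j)\widetilde\theta_{j,n}+\rho\,\widehat P_n(\lambda).$$ $\widehat\lambda\in\operatorname{argmin}_{\lambda\in\Lambda}J_n(\lambda)$ (any one minimizer if not unique), and $\widehat S_*=\widehat S_{\widehat\lambda}$. Constants. $\varrho_n=\max_{\lambda\in\Lambda}\sum_{j=1}^n\lambda(j)$; for $i=1,2$, $\overline\varrho_{i,n}=\max_{\lambda\in\Lambda}\sup_{0\le x\le1}\big|\sum_{j=1}^n\lambda^i(j)\overline\phi_j(x)\big|$ (here $\lambda^i(j)$ is the $i$-th power of $\lambda(j)$); $$\Upsilon_n^*(\rho)=\frac{16\nu}{\rho}+4\overline\varrho_{1,n}\Big(1+\nu\frac{\overline\xi}{\sqrt n}\Big)+4\nu\varrho_n\frac{\overline\xi}{\sqrt n},$$ $$\Psi_n(\rho)=\frac{\rho(1-\rho)\Upsilon_n^*(\rho)+2\nu+2\rho^2(1-\rho)\overline\varrho_{2,n}}{\rho(1-3\rho)}\,\sigma_*.$$ *)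

theory Defs
  imports "HOL-Probability.Probability"
begin

definition design :: "nat \<Rightarrow> nat \<Rightarrow> real" where
  "design n j = real j / real n"

definition emp_inner :: "nat \<Rightarrow> (real \<Rightarrow> real) \<Rightarrow> (real \<Rightarrow> real) \<Rightarrow> real" where
  "emp_inner n f g = (1 / real n) * (\<Sum>l=1..n. f (design n l) * g (design n l))"

definition emp_norm_sq :: "nat \<Rightarrow> (real \<Rightarrow> real) \<Rightarrow> real" where
  "emp_norm_sq n f = emp_inner n f f"

text \<open>The basis is indexed from 1; the index 0 is never used.\<close>

definition trig :: "nat \<Rightarrow> real \<Rightarrow> real" where
  "trig j x =
     (if j = 1 then 1
      else if even j then sqrt 2 * cos (2 * pi * real (j div 2) * x)
      else sqrt 2 * sin (2 * pi * real (j div 2) * x))"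

definition trig_bar :: "nat \<Rightarrow> real \<Rightarrow> real" where
  "trig_bar j x = (trig j x)\<^sup>2 - 1"


text \<open>
  The volatilities and the noise are families indexed by \<open>1, \<dots>, n\<close>, and the volatilities
  depend on the regression function.  Positivity of the volatilities and the bound by
  \<open>\<sigma>star\<close> are only required almost surely.
  The moments of \<open>\<xi> 1\<close> of order 1 and 2 exist because the fourth one does.
\<close>

locale heteroscedastic_regression = prob_space M
  for M :: "'a measure" +
  fixes n :: nat
    and S :: "real \<Rightarrow> real"
    and \<sigma> :: "(real \<Rightarrow> real) \<Rightarrow> nat \<Rightarrow> 'a \<Rightarrow> real"
    and \<xi> :: "nat \<Rightarrow> 'a \<Rightarrow> real"
    and \<xi>star \<sigma>star :: real
  assumes noise_indep: "indep_vars (\<lambda>_. borel) \<xi> {1..n}"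
    and noise_ident: "\<And>j. j \<in> {1..n} \<Longrightarrow> distr M borel (\<xi> j) = distr M borel (\<xi> 1)"
    and noise_mean: "expectation (\<xi> 1) = 0"
    and noise_var: "expectation (\<lambda>\<omega>. (\<xi> 1 \<omega>)\<^sup>2) = 1"
    and noise_fourth_finite: "integrable M (\<lambda>\<omega>. (\<xi> 1 \<omega>) ^ 4)"
    and noise_fourth: "expectation (\<lambda>\<omega>. (\<xi> 1 \<omega>) ^ 4) = \<xi>star"
    and vol_measurable: "\<And>l. l \<in> {1..n} \<Longrightarrow> random_variable borel (\<sigma> S l)"
    and vol_pos: "AE \<omega> in M. \<forall>l\<in>{1..n}. 0 < \<sigma> S l \<omega>"
    and vol_bound: "AE \<omega> in M. \<forall>l\<in>{1..n}. (\<sigma> S l \<omega>)\<^sup>2 \<le> \<sigma>star"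
    and bound_ge_1: "1 \<le> \<sigma>star"
    and vol_noise_indep:
      "indep_var (\<Pi>\<^sub>M l\<in>{1..n}. borel) (\<lambda>\<omega>. \<lambda>l\<in>{1..n}. \<sigma> S l \<omega>)
                 (\<Pi>\<^sub>M l\<in>{1..n}. borel) (\<lambda>\<omega>. \<lambda>l\<in>{1..n}. \<xi> l \<omega>)"

definition observation ::
    "nat \<Rightarrow> (real \<Rightarrow> real) \<Rightarrow> ((real \<Rightarrow> real) \<Rightarrow> nat \<Rightarrow> 'a \<Rightarrow> real) \<Rightarrow> (nat \<Rightarrow> 'a \<Rightarrow> real) \<Rightarrow>
     'a \<Rightarrow> nat \<Rightarrow> real" where
  "observation n S \<sigma> \<xi> \<omega> j = S (design n j) + \<sigma> S j \<omega> * \<xi> j \<omega>"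

definition mean_vol ::
    "nat \<Rightarrow> (real \<Rightarrow> real) \<Rightarrow> ((real \<Rightarrow> real) \<Rightarrow> nat \<Rightarrow> 'a \<Rightarrow> real) \<Rightarrow> 'a \<Rightarrow> real" where
  "mean_vol n S \<sigma> \<omega> = (1 / real n) * (\<Sum>l=1..n. (\<sigma> S l \<omega>)\<^sup>2)"


text \<open>
  The estimators are functions of the data vector \<open>y\<close> and, where needed, of the value \<open>v\<close> of the
  estimator of the mean squared volatility.
\<close>

definition theta_hat :: "nat \<Rightarrow> (nat \<Rightarrow> real) \<Rightarrow> nat \<Rightarrow> real" where
  "theta_hat n y j = (1 / real n) * (\<Sum>l=1..n. y l * trig j (design n l))"

definition weighted_est :: "nat \<Rightarrow> (nat \<Rightarrow> real) \<Rightarrow> (nat \<Rightarrow> real) \<Rightarrow> real \<Rightarrow> real" where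
  "weighted_est n y lam x = (\<Sum>j=1..n. lam j * theta_hat n y j * trig j x)"

definition theta_tilde :: "nat \<Rightarrow> (nat \<Rightarrow> real) \<Rightarrow> real \<Rightarrow> nat \<Rightarrow> real" where
  "theta_tilde n y v j = (theta_hat n y j)\<^sup>2 - (1 / real n) * v"

definition weight_norm_sq :: "nat \<Rightarrow> (nat \<Rightarrow> real) \<Rightarrow> real" where
  "weight_norm_sq n lam = (\<Sum>j=1..n. (lam j)\<^sup>2)"

definition penalty :: "nat \<Rightarrow> real \<Rightarrow> (nat \<Rightarrow> real) \<Rightarrow> real" where
  "penalty n v lam = weight_norm_sq n lam * v / real n"

definition cost :: "nat \<Rightarrow> real \<Rightarrow> (nat \<Rightarrow> real) \<Rightarrow> real \<Rightarrow> (nat \<Rightarrow> real) \<Rightarrow> real" where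
  "cost n \<rho> y v lam =
     (\<Sum>j=1..n. (lam j)\<^sup>2 * (theta_hat n y j)\<^sup>2)
     - 2 * (\<Sum>j=1..n. lam j * theta_tilde n y v j)
     + \<rho> * penalty n v lam"

text \<open>
  A random weight vector \<open>lhat\<close> that is a (measurable) pointwise minimizer over \<open>\<Lambda>\<close> of the
  cost built from the random data \<open>Y\<close> and the random variable \<open>V\<close>.
\<close>

definition cost_minimizer ::
    "'a measure \<Rightarrow> nat \<Rightarrow> real \<Rightarrow> (nat \<Rightarrow> real) set \<Rightarrow> ('a \<Rightarrow> nat \<Rightarrow> real) \<Rightarrow> ('a \<Rightarrow> real) \<Rightarrow>
     ('a \<Rightarrow> nat \<Rightarrow> real) \<Rightarrow> bool" where
  "cost_minimizer M n \<rho> \<Lambda> Y V lhat \<longleftrightarrow>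
     lhat \<in> measurable M (count_space \<Lambda>) \<and>
     (\<forall>\<omega>\<in>space M. is_arg_min (cost n \<rho> (Y \<omega>) (V \<omega>)) (\<lambda>lam. lam \<in> \<Lambda>) (lhat \<omega>))"

text \<open>
  Expectations of nonnegative quantities are taken in the extended nonnegative reals, so that
  no integrability of the estimator \<open>V\<close> has to be assumed.  The weight vector is
  allowed to be random; a fixed weight vector is passed as a constant function.
\<close>

definition risk ::
    "'a measure \<Rightarrow> nat \<Rightarrow> (real \<Rightarrow> real) \<Rightarrow> ('a \<Rightarrow> nat \<Rightarrow> real) \<Rightarrow> ('a \<Rightarrow> nat \<Rightarrow> real) \<Rightarrow> ennreal" where
  "risk M n S Y L =
     (\<integral>\<^sup>+\<omega>. ennreal (emp_norm_sq n (\<lambda>x. weighted_est n (Y \<omega>) (L \<omega>) x - S x)) \<partial>M)"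

definition mean_abs_error :: "'a measure \<Rightarrow> ('a \<Rightarrow> real) \<Rightarrow> ('a \<Rightarrow> real) \<Rightarrow> ennreal" where
  "mean_abs_error M V W = (\<integral>\<^sup>+\<omega>. ennreal \<bar>V \<omega> - W \<omega>\<bar> \<partial>M)"


definition weight_sum_max :: "nat \<Rightarrow> (nat \<Rightarrow> real) set \<Rightarrow> real" where
  "weight_sum_max n \<Lambda> = (MAX lam\<in>\<Lambda>. \<Sum>j=1..n. lam j)"

definition weight_trig_max :: "nat \<Rightarrow> nat \<Rightarrow> (nat \<Rightarrow> real) set \<Rightarrow> real" where
  "weight_trig_max i n \<Lambda> =
     (MAX lam\<in>\<Lambda>. SUP x\<in>{0..1}. \<bar>\<Sum>j=1..n. lam j ^ i * trig_bar j x\<bar>)"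

definition Upsilon_star :: "nat \<Rightarrow> (nat \<Rightarrow> real) set \<Rightarrow> real \<Rightarrow> real \<Rightarrow> real" where
  "Upsilon_star n \<Lambda> \<xi>star \<rho> =
     (let \<nu> = real (card \<Lambda>); \<xi>bar = sqrt (\<xi>star - 1) in
        16 * \<nu> / \<rho>
        + 4 * weight_trig_max 1 n \<Lambda> * (1 + \<nu> * (\<xi>bar / sqrt (real n)))
        + 4 * \<nu> * weight_sum_max n \<Lambda> * (\<xi>bar / sqrt (real n)))"

definition Psi :: "nat \<Rightarrow> (nat \<Rightarrow> real) set \<Rightarrow> real \<Rightarrow> real \<Rightarrow> real \<Rightarrow> real" where
  "Psi n \<Lambda> \<xi>star \<sigma>star \<rho> =
     (\<rho> * (1 - \<rho>) * Upsilon_star n \<Lambda> \<xi>star \<rho> + 2 * real (card \<Lambda>)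
        + 2 * \<rho>\<^sup>2 * (1 - \<rho>) * weight_trig_max 2 n \<Lambda>)
     / (\<rho> * (1 - 3 * \<rho>)) * \<sigma>star"

definition kappa :: "real \<Rightarrow> real" where
  "kappa \<rho> = (6 * \<rho> - 2 * \<rho>\<^sup>2) / (1 - 3 * \<rho>)"

definition kappa_star :: "real \<Rightarrow> real" where
  "kappa_star \<rho> = 4 * (1 - \<rho>\<^sup>2) / (1 - 3 * \<rho>)"

text \<open>
  For \<open>0 < \<rho> < 1/3\<close>, nonempty finite \<open>\<Lambda>\<close> with weights in \<open>[0, 1]\<close> and \<open>\<xi>star \<ge> 1\<close> (which follows
  from the unit variance), \<open>Psi\<close>, \<open>kappa\<close>, \<open>kappa_star\<close> and \<open>weight_sum_max\<close> are all nonnegative,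
  so the coercion \<open>ennreal\<close> does not truncate anything.
  If \<open>weight_sum_max n \<Lambda> = 0\<close>, the product with an infinite mean absolute error is 0.
\<close>

definition B_term ::
    "'a measure \<Rightarrow> nat \<Rightarrow> (nat \<Rightarrow> real) set \<Rightarrow> real \<Rightarrow> real \<Rightarrow> real \<Rightarrow>
     ('a \<Rightarrow> real) \<Rightarrow> ('a \<Rightarrow> real) \<Rightarrow> ennreal" where
  "B_term M n \<Lambda> \<xi>star \<sigma>star \<rho> V W =
     ennreal (Psi n \<Lambda> \<xi>star \<sigma>star \<rho>)
     + ennreal (kappa_star \<rho>) * ennreal (weight_sum_max n \<Lambda>) * mean_abs_error M V W"

end

(*
  Write the empirical Fourier coefficients as true coefficients plus noise.  The loss then equals the
  cost plus a linear signal-noise term, an off-diagonal quadratic form in the noise, a centred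
  diagonal form, the bias caused by unequal volatilities, and the error of the variance estimator.
  Comparing the minimizer lhat with a fixed lam0, each random term is bounded by Young's inequality:
  a small multiple of a quantity absorbed by the losses or the penalties, plus a quotient
  (term)^2 / (its conditional variance).  Summing the quotients over the finite set of weights removes
  the dependence on lhat and costs the factor card Lambda.  All these bounds are nonnegative, so they
  may be integrated conditionally on the volatilities, where only second moments of linear and
  off-diagonal quadratic forms in independent centred variables are needed; there the penalty of lam0
  is also dominated by its own mean loss.  Only orthonormality of the basis on the design is used
  (Bessel instead of Parseval).
*)
theory Submission
  imports Defs
begin

text \<open>The constants come from one self-bounding step. The variance bound for the signal-noise
  term involves the signal energy T of the difference of the two weights, and T depends on unknown
  coefficients. The losses control only its empirical version U, with U at most twice the sum of
  both losses, and T exceeds U by at most a second linear noise term. Young's inequality for that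
  term costs \<rho> T again, so (1 - \<rho>) T is at most U plus noise. Inserting this into
  loss(\<open>lhat\<close>) \<le> loss(\<open>lam0\<close>) + \<rho> T + ..., multiplied by 1 -
  \<rho>, produces the factors 1 - 3\<rho> and 1 + \<rho>; hence \<rho> < 1/3. A penalty of
  \<open>lam0\<close> with coefficient 2\<rho>(1 - \<rho>) remains, and trading it for the mean loss
  gives (1 + \<rho> + 2\<rho>(1 - \<rho>)) / (1 - 3\<rho>) = 1 + \<open>kappa \<rho>\<close>. The
  obstacle is that \<open>lhat\<close> and \<open>V\<close> may depend on the noise in any way and
  that \<open>V\<close> may have infinite mean. So the comparison is made outcome by outcome, and
  moments are computed only for quantities free of both; \<open>V\<close> survives only in its
  absolute error.\<close>

section \<open>Orthonormality of the trigonometric basis on the design\<close>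

lemma trig_sq_le_2: "(trig j x)\<^sup>2 \<le> 2"
proof -
  have *: "(sqrt 2 * u)\<^sup>2 \<le> 2" if "\<bar>u\<bar> \<le> 1" for u :: real
    using that by (simp add: power_mult_distrib abs_square_le_1)
  show ?thesis
    by (simp add: trig_def *)
qed

lemma abs_trig_bar_le_1: "\<bar>trig_bar j x\<bar> \<le> 1"
  using trig_sq_le_2[of j x] zero_le_power2[of "trig j x"]
  unfolding trig_bar_def by linarith

text \<open>Multiplying by 2 sin(h/2) turns each summand into a difference of values at consecutive
  half-integer multiples of h, so the sums telescope.\<close>

lemma sum_cos_sin_telescope:
  fixes h :: real
  shows "2 * sin (h / 2) * (\<Sum>l=1..n. cos (real l * h)) = sin (real n * h + h / 2) - sin (h / 2)"
    and "2 * sin (h / 2) * (\<Sum>l=1..n. sin (real l * h)) = cos (h / 2) - cos (real n * h + h / 2)"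
proof (induction n)
  case (Suc n)
  have step: "2 * sin (h / 2) * cos u = sin (u + h / 2) - sin (u - h / 2)"
    "2 * sin (h / 2) * sin u = cos (u - h / 2) - cos (u + h / 2)" for u
    by (simp_all add: sin_add sin_diff cos_add cos_diff)
  have shift: "real n * h + h / 2 = real (Suc n) * h - h / 2"
    by (simp add: algebra_simps)
  have sum_Suc: "(\<Sum>l=1..Suc n. f l) = (\<Sum>l=1..n. f l) + f (Suc n)" for f :: "nat \<Rightarrow> real"
    by simp
  { case 1 show ?case using Suc(1) step(1)[of "real (Suc n) * h"]
      unfolding shift sum_Suc distrib_left by linarith }
  { case 2 show ?case using Suc(2) step(2)[of "real (Suc n) * h"]
      unfolding shift sum_Suc distrib_left by linarith }
qed simp_all

text \<open>Here n h is a multiple of 2 pi, so the two ends of the telescoped sum cancel. For 0 < k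
  < n the angle h/2 lies strictly between 0 and pi, which allows division by sin(h/2).\<close>

lemma sum_cos_sin_roots:
  fixes k n :: nat
  assumes "k < n"
  shows "(\<Sum>l=1..n. cos (real l * (2 * pi * real k / real n))) = (if k = 0 then real n else 0)"
    and "(\<Sum>l=1..n. sin (real l * (2 * pi * real k / real n))) = 0"
proof -
  define h where "h = 2 * pi * real k / real n"
  have nh: "real n * h = 2 * pi * real k"
    using assms by (simp add: h_def)
  have per: "sin (real n * h + h / 2) = sin (h / 2)" "cos (real n * h + h / 2) = cos (h / 2)"
    using sin_2npi[of k] cos_2npi[of k] unfolding nh
    by (simp_all add: sin_add cos_add ac_simps del: sin_2npi cos_2npi)
  have nz: "sin (h / 2) \<noteq> 0" if "k \<noteq> 0"
  proof -
    have "0 < h / 2" "h / 2 < pi"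
      using assms that by (simp_all add: h_def field_simps)
    then show ?thesis using sin_gt_zero by fastforce
  qed
  have "(\<Sum>l=1..n. cos (real l * h)) = (if k = 0 then real n else 0)"
    using sum_cos_sin_telescope(1)[of h n] nz per by (auto simp: h_def)
  then show "(\<Sum>l=1..n. cos (real l * (2 * pi * real k / real n))) = (if k = 0 then real n else 0)"
    by (simp add: h_def)
  have "(\<Sum>l=1..n. sin (real l * h)) = 0"
    using sum_cos_sin_telescope(2)[of h n] nz per by (cases "k = 0") (auto simp: h_def)
  then show "(\<Sum>l=1..n. sin (real l * (2 * pi * real k / real n))) = 0"
    by (simp add: h_def)
qed

text \<open>The product formulas reduce everything to the frequencies a + b and |a - b|; both are
  below n, so they vanish modulo n only if they are zero.\<close>

lemma sum_trig_products:
  fixes a b n :: nat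
  assumes "a + b < n"
    and t_def: "\<And>k l. t k l = real l * (2 * pi * real k / real n)"
  shows "(\<Sum>l=1..n. cos (t a l) * cos (t b l))
           = (if a = b then if a = 0 then real n else real n / 2 else 0)"
    and "(\<Sum>l=1..n. sin (t a l) * sin (t b l)) = (if a = b \<and> a \<noteq> 0 then real n / 2 else 0)"
    and "(\<Sum>l=1..n. sin (t a l) * cos (t b l)) = 0"
proof -
  \<comment> \<open>Subtraction of naturals truncates, so the absolute difference is written by
    cases; cosine ignores the sign and sine picks it up in \<open>sd\<close>.\<close>
  define d where "d = (if a \<le> b then b - a else a - b)"
  have d: "d < n" using assms(1) by (auto simp: d_def)
  have ts: "t (a + b) l = t a l + t b l" for l
    by (simp add: t_def distrib_left distrib_right add_divide_distrib)
  have td: "t d l = (if a \<le> b then t b l - t a l else t a l - t b l)" for l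
    by (simp add: t_def d_def left_diff_distrib right_diff_distrib diff_divide_distrib of_nat_diff)
  have cd: "cos (t d l) = cos (t a l - t b l)" for l
    unfolding td by (simp add: cos_diff)
  have sd: "sin (t a l - t b l) = (if a \<le> b then - 1 else 1) * sin (t d l)" for l
    unfolding td by (simp add: sin_diff)
  have cosd: "(\<Sum>l=1..n. cos (t d l)) = (if a = b then real n else 0)"
    using sum_cos_sin_roots(1)[OF d] by (auto simp: t_def d_def split: if_splits)
  have coss: "(\<Sum>l=1..n. cos (t (a + b) l)) = (if a = 0 \<and> b = 0 then real n else 0)"
    using sum_cos_sin_roots(1)[OF assms(1)] by (auto simp: t_def)
  have sins: "(\<Sum>l=1..n. sin (t (a + b) l)) = 0" "(\<Sum>l=1..n. sin (t d l)) = 0"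
    using sum_cos_sin_roots(2)[OF assms(1)] sum_cos_sin_roots(2)[OF d] by (simp_all only: t_def)
  have "(\<Sum>l=1..n. cos (t a l) * cos (t b l)) = (\<Sum>l=1..n. cos (t d l) / 2 + cos (t (a + b) l) / 2)"
    unfolding cd ts by (simp add: cos_times_cos add_divide_distrib)
  then show "(\<Sum>l=1..n. cos (t a l) * cos (t b l))
           = (if a = b then if a = 0 then real n else real n / 2 else 0)"
    unfolding sum.distrib sum_divide_distrib[symmetric] cosd coss by auto
  have "(\<Sum>l=1..n. sin (t a l) * sin (t b l)) = (\<Sum>l=1..n. cos (t d l) / 2 - cos (t (a + b) l) / 2)"
    unfolding cd ts by (simp add: sin_times_sin diff_divide_distrib)
  then show "(\<Sum>l=1..n. sin (t a l) * sin (t b l)) = (if a = b \<and> a \<noteq> 0 then real n / 2 else 0)"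
    unfolding sum_subtractf sum_divide_distrib[symmetric] cosd coss by auto
  have "(\<Sum>l=1..n. sin (t a l) * cos (t b l))
      = (\<Sum>l=1..n. sin (t (a + b) l) / 2 + (if a \<le> b then - 1 else 1) * sin (t d l) / 2)"
    unfolding sd[symmetric] ts by (simp add: sin_times_cos add_divide_distrib)
  then show "(\<Sum>l=1..n. sin (t a l) * cos (t b l)) = 0"
    unfolding sum.distrib sum_divide_distrib[symmetric] sum_distrib_left[symmetric] sins by simp
qed

text \<open>Oddness of n is what makes this work: every frequency is at most (n - 1)/2, so two of
  them add up to less than n and no aliasing occurs.\<close>

lemma trig_orthonormal:
  assumes "odd n" "i \<in> {1..n}" "j \<in> {1..n}"
  shows "(\<Sum>l=1..n. trig i (design n l) * trig j (design n l)) = (if i = j then real n else 0)"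
proof -
  define t where "t = (\<lambda>k l. real l * (2 * pi * real k / real n))"
  have t: "t k l = real l * (2 * pi * real k / real n)" for k l
    by (simp add: t_def)
  have "i div 2 \<le> n div 2" "j div 2 \<le> n div 2"
    using assms by (simp_all add: div_le_mono)
  moreover have "n = 2 * (n div 2) + 1"
    using assms(1) by simp
  ultimately have ab: "i div 2 + j div 2 < n" "j div 2 + i div 2 < n"
    by linarith+
  \<comment> \<open>Index 1 is odd but has frequency 0; it is represented by a cosine, and without
    the factor sqrt 2.\<close>
  have tr: "trig k (design n l) = (if k = 1 then cos (t 0 l)
      else sqrt 2 * (if even k then cos (t (k div 2) l) else sin (t (k div 2) l)))" for k l
    by (simp add: trig_def design_def t_def ac_simps)
  note S = sum_trig_products[OF ab(1) t] sum_trig_products[OF ab(2) t]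
  have [simp]: "k div 2 = 0 \<longleftrightarrow> k = 1" if "k \<ge> 1" for k :: nat
    using that by auto
  \<comment> \<open>The indices 2k and 2k + 1 share the frequency k, so parity is needed to recover
    the index.\<close>
  have ij: "i div 2 = j div 2 \<longleftrightarrow> i = j" if "even i \<longleftrightarrow> even j"
    using that by (metis div_mult_mod_eq parity_cases)
  have ge: "i \<ge> 1" "j \<ge> 1" using assms by auto
  have c: "(\<Sum>l\<in>A. (sqrt 2 * f l) * (sqrt 2 * g l)) = 2 * (\<Sum>l\<in>A. f l * g l)"
       "(\<Sum>l\<in>A. f l * (sqrt 2 * g l)) = sqrt 2 * (\<Sum>l\<in>A. f l * g l)"
       "(\<Sum>l\<in>A. (sqrt 2 * f l) * g l) = sqrt 2 * (\<Sum>l\<in>A. f l * g l)"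
    for f g :: "nat \<Rightarrow> real" and A
    by (simp_all add: sum_distrib_left ac_simps)
  have comm: "(\<Sum>l=1..n. cos (t (i div 2) l) * sin (t (j div 2) l)) = 0"
    using S(6) by (simp only: mult.commute)
  consider "i = 1" "j = 1" | "i = 1" "j \<noteq> 1" | "i \<noteq> 1" "j = 1" | "i \<noteq> 1" "j \<noteq> 1"
    by blast
  then show ?thesis
  proof cases
    case 1
    then show ?thesis by (simp add: trig_def)
  next
    case 2
    then show ?thesis
      using S(1,6) ge by (cases "even j") (simp_all add: tr c mult.commute)
  next
    case 3
    then show ?thesis
      using S(1,3) ge by (cases "even i") (simp_all add: tr c mult.commute)
  next
    case 4
    have "(\<Sum>l=1..n. trig i (design n l) * trig j (design n l))
      = 2 * (\<Sum>l=1..n. (if even i then cos (t (i div 2) l) else sin (t (i div 2) l))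
                    * (if even j then cos (t (j div 2) l) else sin (t (j div 2) l)))"
      using 4 by (simp only: tr c if_False)
    also have "\<dots> = (if i = j then real n else 0)"
      using 4 ge ij by (cases "even i"; cases "even j") (simp_all only: if_True if_False S comm, auto)
    finally show ?thesis .
  qed
qed

section \<open>Second moments of forms in independent variables\<close>

lemma (in prob_space) integrable_mult_of_square:
  fixes X Y :: "'a \<Rightarrow> real"
  assumes [measurable]: "X \<in> borel_measurable M" "Y \<in> borel_measurable M"
    and "integrable M (\<lambda>\<omega>. (X \<omega>)\<^sup>2)" "integrable M (\<lambda>\<omega>. (Y \<omega>)\<^sup>2)"
  shows "integrable M (\<lambda>\<omega>. X \<omega> * Y \<omega>)"
proof (rule Bochner_Integration.integrable_bound)
  show "integrable M (\<lambda>\<omega>. (X \<omega>)\<^sup>2 + (Y \<omega>)\<^sup>2)"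
    using assms by simp
  have "\<bar>x * y\<bar> \<le> x\<^sup>2 + y\<^sup>2" for x y :: real
  proof -
    have "2 * (\<bar>x\<bar> * \<bar>y\<bar>) \<le> x\<^sup>2 + y\<^sup>2"
      using sum_squares_bound[of "\<bar>x\<bar>" "\<bar>y\<bar>"] by (simp add: mult.assoc)
    moreover have "0 \<le> \<bar>x\<bar> * \<bar>y\<bar>" by simp
    ultimately show ?thesis unfolding abs_mult by linarith
  qed
  then show "AE \<omega> in M. norm (X \<omega> * Y \<omega>) \<le> norm ((X \<omega>)\<^sup>2 + (Y \<omega>)\<^sup>2)"
    by simp
qed simp

lemma (in prob_space) square_integrable_add:
  fixes X Y :: "'a \<Rightarrow> real"
  assumes [measurable]: "X \<in> borel_measurable M" "Y \<in> borel_measurable M"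
    and X: "integrable M (\<lambda>\<omega>. (X \<omega>)\<^sup>2)" and Y: "integrable M (\<lambda>\<omega>. (Y \<omega>)\<^sup>2)"
  shows "integrable M (\<lambda>\<omega>. (X \<omega> + Y \<omega>)\<^sup>2)"
    and "expectation (\<lambda>\<omega>. (X \<omega> + Y \<omega>)\<^sup>2)
      = expectation (\<lambda>\<omega>. (X \<omega>)\<^sup>2) + 2 * expectation (\<lambda>\<omega>. X \<omega> * Y \<omega>) + expectation (\<lambda>\<omega>. (Y \<omega>)\<^sup>2)"
proof -
  have XY: "integrable M (\<lambda>\<omega>. X \<omega> * Y \<omega>)"
    by (rule integrable_mult_of_square) fact+
  have eq: "(X \<omega> + Y \<omega>)\<^sup>2 = (X \<omega>)\<^sup>2 + 2 * (X \<omega> * Y \<omega>) + (Y \<omega>)\<^sup>2" for \<omega>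
    by (simp add: power2_sum)
  show "integrable M (\<lambda>\<omega>. (X \<omega> + Y \<omega>)\<^sup>2)"
    "expectation (\<lambda>\<omega>. (X \<omega> + Y \<omega>)\<^sup>2)
      = expectation (\<lambda>\<omega>. (X \<omega>)\<^sup>2) + 2 * expectation (\<lambda>\<omega>. X \<omega> * Y \<omega>) + expectation (\<lambda>\<omega>. (Y \<omega>)\<^sup>2)"
    unfolding eq using X Y XY by simp_all
qed

lemma (in prob_space) square_integrable_imp_abs:
  fixes X :: "'a \<Rightarrow> real"
  assumes [measurable]: "X \<in> borel_measurable M"
    and X: "integrable M (\<lambda>\<omega>. (X \<omega>)\<^sup>2)"
  shows "integrable M X" "expectation (\<lambda>\<omega>. \<bar>X \<omega>\<bar>) \<le> sqrt (expectation (\<lambda>\<omega>. (X \<omega>)\<^sup>2))"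
proof -
  show int: "integrable M X"
    using integrable_mult_of_square[of X "\<lambda>_. 1"] X by simp
  \<comment> \<open>The variance of |X| is nonnegative, which is Cauchy-Schwarz against the constant
    1.\<close>
  have "(expectation (\<lambda>\<omega>. \<bar>X \<omega>\<bar>))\<^sup>2 \<le> expectation (\<lambda>\<omega>. (X \<omega>)\<^sup>2)"
    using variance_eq[of "\<lambda>\<omega>. \<bar>X \<omega>\<bar>"] variance_positive[of "\<lambda>\<omega>. \<bar>X \<omega>\<bar>"] int X by simp
  then show "expectation (\<lambda>\<omega>. \<bar>X \<omega>\<bar>) \<le> sqrt (expectation (\<lambda>\<omega>. (X \<omega>)\<^sup>2))"
    by (rule real_le_rsqrt)
qed

text \<open>The common induction step of the two moment computations below: \<open>g\<close> depends
  only on the variables indexed by \<open>A\<close>, as \<open>f\<close> witnesses, and is therefore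
  independent of the new variable \<open>X k\<close>.\<close>

lemma (in prob_space) indep_vars_centered_mult:
  fixes X :: "'i \<Rightarrow> 'a \<Rightarrow> real"
  assumes ind: "indep_vars (\<lambda>_. borel) X I" and k: "k \<in> I" "A \<subseteq> I" "k \<notin> A"
    and sq: "integrable M (\<lambda>\<omega>. (X k \<omega>)\<^sup>2)" and mean: "expectation (X k) = 0"
    and f [measurable]: "f \<in> borel_measurable (\<Pi>\<^sub>M i\<in>A. borel)"
    and g: "\<And>\<omega>. g \<omega> = f (\<lambda>i\<in>A. X i \<omega>)"
  shows "integrable M g \<Longrightarrow> expectation (\<lambda>\<omega>. g \<omega> * X k \<omega>) = 0"
    and "integrable M g \<Longrightarrow> integrable M (\<lambda>\<omega>. g \<omega> * (X k \<omega>)\<^sup>2)"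
    and "integrable M g \<Longrightarrow>
      expectation (\<lambda>\<omega>. g \<omega> * (X k \<omega>)\<^sup>2) = expectation g * expectation (\<lambda>\<omega>. (X k \<omega>)\<^sup>2)"
proof -
  have [measurable]: "X i \<in> borel_measurable M" if "i \<in> I" for i
    using ind that by (auto simp: indep_vars_def)
  have int: "integrable M (X k)"
    by (rule square_integrable_imp_abs(1)) (use k sq in auto)
  have "indep_var (PiM A (\<lambda>_. borel)) (\<lambda>\<omega>. \<lambda>i\<in>A. X i \<omega>) (PiM {k} (\<lambda>_. borel)) (\<lambda>\<omega>. \<lambda>i\<in>{k}. X i \<omega>)"
    using k by (intro indep_var_restrict[OF ind]) auto
  note ind2 = indep_var_compose[OF this f]
  have g': "f \<circ> (\<lambda>\<omega>. \<lambda>i\<in>A. X i \<omega>) = g"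
    by (rule ext) (simp only: comp_def g)
  have "(\<lambda>x. x k) \<circ> (\<lambda>\<omega>. \<lambda>i\<in>{k}. X i \<omega>) = X k"
    "(\<lambda>x. (x k)\<^sup>2) \<circ> (\<lambda>\<omega>. \<lambda>i\<in>{k}. X i \<omega>) = (\<lambda>\<omega>. (X k \<omega>)\<^sup>2)"
    by (simp_all add: fun_eq_iff)
  then have 1: "indep_var borel g borel (X k)" and 2: "indep_var borel g borel (\<lambda>\<omega>. (X k \<omega>)\<^sup>2)"
    using ind2[of "\<lambda>x. x k" borel] ind2[of "\<lambda>x. (x k)\<^sup>2" borel] unfolding g' by simp_all
  assume "integrable M g"
  then show "expectation (\<lambda>\<omega>. g \<omega> * X k \<omega>) = 0"
    "integrable M (\<lambda>\<omega>. g \<omega> * (X k \<omega>)\<^sup>2)"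
    "expectation (\<lambda>\<omega>. g \<omega> * (X k \<omega>)\<^sup>2) = expectation g * expectation (\<lambda>\<omega>. (X k \<omega>)\<^sup>2)"
    using indep_var_lebesgue_integral[OF 1] indep_var_lebesgue_integral[OF 2]
      indep_var_integrable[OF 2] int sq mean by simp_all
qed

text \<open>A new variable is independent of the partial sum and centred, so the cross term has mean
  zero. The variance \<open>v\<close> is general because the form is used both for the noise and for
  its centred squares.\<close>

lemma (in prob_space) second_moment_linear_form:
  fixes X :: "'i \<Rightarrow> 'a \<Rightarrow> real"
  assumes ind: "indep_vars (\<lambda>_. borel) X I" and "finite J" "J \<subseteq> I"
    and sq: "\<And>i. i \<in> I \<Longrightarrow> integrable M (\<lambda>\<omega>. (X i \<omega>)\<^sup>2)"
    and mean: "\<And>i. i \<in> I \<Longrightarrow> expectation (X i) = 0"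
    and var: "\<And>i. i \<in> I \<Longrightarrow> expectation (\<lambda>\<omega>. (X i \<omega>)\<^sup>2) = v"
  shows "integrable M (\<lambda>\<omega>. (\<Sum>i\<in>J. c i * X i \<omega>)\<^sup>2)"
    and "expectation (\<lambda>\<omega>. (\<Sum>i\<in>J. c i * X i \<omega>)\<^sup>2) = v * (\<Sum>i\<in>J. (c i)\<^sup>2)"
proof -
  have [measurable]: "X i \<in> borel_measurable M" if "i \<in> I" for i
    using ind that by (auto simp: indep_vars_def)
  have "integrable M (\<lambda>\<omega>. (\<Sum>i\<in>J. c i * X i \<omega>)\<^sup>2)
     \<and> expectation (\<lambda>\<omega>. (\<Sum>i\<in>J. c i * X i \<omega>)\<^sup>2) = v * (\<Sum>i\<in>J. (c i)\<^sup>2)"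
    using \<open>finite J\<close> \<open>J \<subseteq> I\<close>
  proof (induction J)
    case (insert k A)
    define L where "L = (\<lambda>\<omega>. \<Sum>i\<in>A. c i * X i \<omega>)"
    have k: "k \<in> I" "A \<subseteq> I" "k \<notin> A" using insert by auto
    have [measurable]: "L \<in> borel_measurable M" "X k \<in> borel_measurable M"
      using k by (auto simp: L_def intro!: borel_measurable_sum borel_measurable_times)
    have L2: "integrable M (\<lambda>\<omega>. (L \<omega>)\<^sup>2)" "expectation (\<lambda>\<omega>. (L \<omega>)\<^sup>2) = v * (\<Sum>i\<in>A. (c i)\<^sup>2)"
      using insert k by (auto simp: L_def)
    have "integrable M L"
      by (rule square_integrable_imp_abs(1)) (use L2 in auto)
    then have "expectation (\<lambda>\<omega>. L \<omega> * X k \<omega>) = 0"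
      by (rule indep_vars_centered_mult(1)[OF ind k sq mean, of "\<lambda>x. \<Sum>i\<in>A. c i * x i", rotated 4])
         (use k in \<open>auto simp: L_def\<close>)
    moreover have "(\<lambda>\<omega>. (c k * X k \<omega>) * L \<omega>) = (\<lambda>\<omega>. c k * (L \<omega> * X k \<omega>))"
      by (rule ext) (simp only: ac_simps)
    ultimately have "expectation (\<lambda>\<omega>. (c k * X k \<omega>) * L \<omega>) = 0"
      by simp
    moreover have "integrable M (\<lambda>\<omega>. (c k * X k \<omega>)\<^sup>2)"
      "expectation (\<lambda>\<omega>. (c k * X k \<omega>)\<^sup>2) = (c k)\<^sup>2 * v"
      using sq[of k] var[of k] k by (simp_all add: power_mult_distrib)
    moreover have "(\<Sum>i\<in>insert k A. c i * X i \<omega>) = c k * X k \<omega> + L \<omega>" for \<omega>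
      using insert.hyps by (simp add: L_def)
    ultimately show ?case
      using insert.hyps square_integrable_add[of "\<lambda>\<omega>. c k * X k \<omega>" L] L2
      by (simp add: distrib_left mult.commute[of v])
  qed simp
  then show "integrable M (\<lambda>\<omega>. (\<Sum>i\<in>J. c i * X i \<omega>)\<^sup>2)"
    "expectation (\<lambda>\<omega>. (\<Sum>i\<in>J. c i * X i \<omega>)\<^sup>2) = v * (\<Sum>i\<in>J. (c i)\<^sup>2)" by auto
qed

text \<open>Adding an index k adds 2 L X_k with L linear in the earlier variables. The cross term
  with the old form is centred in X_k, and L^2 is independent of X_k^2, so second moments suffice.
  The increment 4 a^2 for an unordered pair is 2 a^2 for each ordered pair.\<close>

lemma (in prob_space) second_moment_off_diagonal_form:
  fixes X :: "'i \<Rightarrow> 'a \<Rightarrow> real"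
  assumes ind: "indep_vars (\<lambda>_. borel) X I" and "finite J" "J \<subseteq> I"
    and sq: "\<And>i. i \<in> I \<Longrightarrow> integrable M (\<lambda>\<omega>. (X i \<omega>)\<^sup>2)"
    and mean: "\<And>i. i \<in> I \<Longrightarrow> expectation (X i) = 0"
    and var: "\<And>i. i \<in> I \<Longrightarrow> expectation (\<lambda>\<omega>. (X i \<omega>)\<^sup>2) = 1"
    and sym: "\<And>i j. a i j = a j i"
  shows "integrable M (\<lambda>\<omega>. (\<Sum>i\<in>J. \<Sum>j\<in>J - {i}. a i j * X i \<omega> * X j \<omega>)\<^sup>2)"
    and "expectation (\<lambda>\<omega>. (\<Sum>i\<in>J. \<Sum>j\<in>J - {i}. a i j * X i \<omega> * X j \<omega>)\<^sup>2)
      = 2 * (\<Sum>i\<in>J. \<Sum>j\<in>J - {i}. (a i j)\<^sup>2)"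
proof -
  have [measurable]: "X i \<in> borel_measurable M" if "i \<in> I" for i
    using ind that by (auto simp: indep_vars_def)
  \<comment> \<open>The new index contributes a row and a column, equal by symmetry.\<close>
  have split: "(\<Sum>i\<in>insert k A. \<Sum>j\<in>insert k A - {i}. b i j)
      = (\<Sum>i\<in>A. \<Sum>j\<in>A - {i}. b i j) + 2 * (\<Sum>i\<in>A. b i k)"
    if "finite A" "k \<notin> A" "\<And>i. b i k = b k i" for k A and b :: "'i \<Rightarrow> 'i \<Rightarrow> real"
  proof -
    have "(\<Sum>j\<in>insert k A - {i}. b i j) = b i k + (\<Sum>j\<in>A - {i}. b i j)" if "i \<in> A" for i
    proof -
      have "insert k A - {i} = insert k (A - {i})" using that \<open>k \<notin> A\<close> by auto
      then show ?thesis using \<open>finite A\<close> \<open>k \<notin> A\<close> by simp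
    qed
    then show ?thesis using that by (simp add: sum.distrib)
  qed
  have "integrable M (\<lambda>\<omega>. (\<Sum>i\<in>J. \<Sum>j\<in>J - {i}. a i j * X i \<omega> * X j \<omega>)\<^sup>2)
    \<and> expectation (\<lambda>\<omega>. (\<Sum>i\<in>J. \<Sum>j\<in>J - {i}. a i j * X i \<omega> * X j \<omega>)\<^sup>2)
      = 2 * (\<Sum>i\<in>J. \<Sum>j\<in>J - {i}. (a i j)\<^sup>2)"
    using \<open>finite J\<close> \<open>J \<subseteq> I\<close>
  proof (induction J)
    case (insert k A)
    define Q where "Q = (\<lambda>\<omega>. \<Sum>i\<in>A. \<Sum>j\<in>A - {i}. a i j * X i \<omega> * X j \<omega>)"
    define L where "L = (\<lambda>\<omega>. \<Sum>i\<in>A. a i k * X i \<omega>)"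
    have k: "k \<in> I" "A \<subseteq> I" "k \<notin> A" using insert by auto
    have [measurable]: "L \<in> borel_measurable M" "X k \<in> borel_measurable M" "Q \<in> borel_measurable M"
      using k by (auto simp: L_def Q_def intro!: borel_measurable_sum borel_measurable_times)
    have Q2: "integrable M (\<lambda>\<omega>. (Q \<omega>)\<^sup>2)"
      "expectation (\<lambda>\<omega>. (Q \<omega>)\<^sup>2) = 2 * (\<Sum>i\<in>A. \<Sum>j\<in>A - {i}. (a i j)\<^sup>2)"
      using insert k by (auto simp: Q_def)
    have L2: "integrable M (\<lambda>\<omega>. (L \<omega>)\<^sup>2)" "expectation (\<lambda>\<omega>. (L \<omega>)\<^sup>2) = (\<Sum>i\<in>A. (a i k)\<^sup>2)"
      using second_moment_linear_form[OF ind insert(1) k(2) sq mean var, of "\<lambda>i. a i k"]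
      by (simp_all add: L_def)
    have *: "expectation (\<lambda>\<omega>. (Q \<omega> * L \<omega>) * X k \<omega>) = 0"
    proof (rule indep_vars_centered_mult(1)[OF ind k sq mean,
          of "\<lambda>x. (\<Sum>i\<in>A. \<Sum>j\<in>A - {i}. a i j * x i * x j) * (\<Sum>i\<in>A. a i k * x i)"])
      show "integrable M (\<lambda>\<omega>. Q \<omega> * L \<omega>)"
        by (rule integrable_mult_of_square) (use L2 Q2 in auto)
    qed (use k in \<open>auto simp: L_def Q_def intro!: sum.cong borel_measurable_sum borel_measurable_times arg_cong2[where f="(*)"]\<close>)
    have QLX: "expectation (\<lambda>\<omega>. Q \<omega> * (2 * L \<omega> * X k \<omega>)) = 0"
    proof -
      have "(\<lambda>\<omega>. Q \<omega> * (2 * L \<omega> * X k \<omega>)) = (\<lambda>\<omega>. 2 * ((Q \<omega> * L \<omega>) * X k \<omega>))"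
        by (rule ext) (simp only: ac_simps)
      with * show ?thesis by simp
    qed
    have L: "(L \<omega>)\<^sup>2 = (\<Sum>i\<in>A. a i k * (\<lambda>i\<in>A. X i \<omega>) i)\<^sup>2" for \<omega>
      by (simp add: L_def)
    have "(\<lambda>x. (\<Sum>i\<in>A. a i k * x i)\<^sup>2) \<in> borel_measurable (\<Pi>\<^sub>M i\<in>A. borel)"
      by measurable
    from indep_vars_centered_mult(2,3)[OF ind k sq mean this L L2(1)]
    have "integrable M (\<lambda>\<omega>. (L \<omega>)\<^sup>2 * (X k \<omega>)\<^sup>2)
      \<and> expectation (\<lambda>\<omega>. (L \<omega>)\<^sup>2 * (X k \<omega>)\<^sup>2) = (\<Sum>i\<in>A. (a i k)\<^sup>2)"
      using k L2 var by simp
    then have LX: "integrable M (\<lambda>\<omega>. (2 * L \<omega> * X k \<omega>)\<^sup>2)"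
      "expectation (\<lambda>\<omega>. (2 * L \<omega> * X k \<omega>)\<^sup>2) = 4 * (\<Sum>i\<in>A. (a i k)\<^sup>2)"
      by (simp_all add: power_mult_distrib mult.assoc)
    have "(\<Sum>i\<in>insert k A. \<Sum>j\<in>insert k A - {i}. a i j * X i \<omega> * X j \<omega>) = Q \<omega> + 2 * L \<omega> * X k \<omega>" for \<omega>
      by (subst split) (use insert in \<open>auto simp: Q_def L_def sym ac_simps sum_distrib_left sum_distrib_right\<close>)
    moreover have "(\<Sum>i\<in>insert k A. \<Sum>j\<in>insert k A - {i}. (a i j)\<^sup>2)
        = (\<Sum>i\<in>A. \<Sum>j\<in>A - {i}. (a i j)\<^sup>2) + 2 * (\<Sum>i\<in>A. (a i k)\<^sup>2)"
      by (subst split) (use insert sym in auto)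
    ultimately show ?case
      using square_integrable_add[of Q "\<lambda>\<omega>. 2 * L \<omega> * X k \<omega>"] Q2 LX QLX by simp
  qed simp
  then show "integrable M (\<lambda>\<omega>. (\<Sum>i\<in>J. \<Sum>j\<in>J - {i}. a i j * X i \<omega> * X j \<omega>)\<^sup>2)"
    "expectation (\<lambda>\<omega>. (\<Sum>i\<in>J. \<Sum>j\<in>J - {i}. a i j * X i \<omega> * X j \<omega>)\<^sup>2)
      = 2 * (\<Sum>i\<in>J. \<Sum>j\<in>J - {i}. (a i j)\<^sup>2)" by auto
qed

text \<open>Tonelli for the product law. Both integrals are written over \<open>M\<close>, so
  \<open>X\<close> can be frozen at one outcome while moment bounds for variables on
  \<open>M\<close> apply to the inner integral.\<close>

lemma (in prob_space) indep_var_nn_integral_split: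
  assumes ind: "indep_var A X B Y" and F [measurable]: "F \<in> borel_measurable (A \<Otimes>\<^sub>M B)"
  shows "(\<integral>\<^sup>+\<omega>. F (X \<omega>, Y \<omega>) \<partial>M) = (\<integral>\<^sup>+\<omega>. (\<integral>\<^sup>+\<omega>'. F (X \<omega>, Y \<omega>') \<partial>M) \<partial>M)"
proof -
  have [measurable]: "X \<in> measurable M A" "Y \<in> measurable M B"
    using ind by (auto dest: indep_var_rv1 indep_var_rv2)
  interpret Y: prob_space "distr M B Y"
    by (rule prob_space_distr) simp
  have "(\<integral>\<^sup>+\<omega>. F (X \<omega>, Y \<omega>) \<partial>M) = (\<integral>\<^sup>+p. F p \<partial>distr M (A \<Otimes>\<^sub>M B) (\<lambda>\<omega>. (X \<omega>, Y \<omega>)))"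
    by (subst nn_integral_distr) simp_all
  also have "\<dots> = (\<integral>\<^sup>+p. F p \<partial>(distr M A X \<Otimes>\<^sub>M distr M B Y))"
    using ind by (simp add: indep_var_distribution_eq)
  also have "\<dots> = (\<integral>\<^sup>+x. \<integral>\<^sup>+y. F (x, y) \<partial>distr M B Y \<partial>distr M A X)"
    by (rule Y.nn_integral_fst[symmetric]) (simp cong: measurable_cong_sets)
  also have "\<dots> = (\<integral>\<^sup>+\<omega>. (\<integral>\<^sup>+\<omega>'. F (X \<omega>, Y \<omega>') \<partial>M) \<partial>M)"
  proof -
    have "(\<integral>\<^sup>+y. F (x, y) \<partial>distr M B Y) = (\<integral>\<^sup>+\<omega>'. F (x, Y \<omega>') \<partial>M)" if "x \<in> space A" for x
      using that by (subst nn_integral_distr) simp_all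
    moreover have "X \<omega> \<in> space A" if "\<omega> \<in> space M" for \<omega>
      using measurable_space[OF _ that, of X A] by simp
    ultimately show ?thesis
      by (subst nn_integral_distr) (simp_all cong: nn_integral_cong)
  qed
  finally show ?thesis .
qed

section \<open>Pathwise comparison of losses\<close>

text \<open>The notions from here on take fixed vectors \<open>s\<close> and \<open>z\<close> in
  place of the random volatilities and noise. They can then be read at a single outcome, or
  integrated over the noise with the volatilities frozen.\<close>

definition model_obs :: "nat \<Rightarrow> (real \<Rightarrow> real) \<Rightarrow> (nat \<Rightarrow> real) \<Rightarrow> (nat \<Rightarrow> real) \<Rightarrow> nat \<Rightarrow> real" where
  "model_obs n S s z l = S (design n l) + s l * z l"

definition fourier_coef :: "nat \<Rightarrow> (real \<Rightarrow> real) \<Rightarrow> nat \<Rightarrow> real" where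
  "fourier_coef n S = theta_hat n (\<lambda>l. S (design n l))"

definition noise_coef :: "nat \<Rightarrow> (nat \<Rightarrow> real) \<Rightarrow> (nat \<Rightarrow> real) \<Rightarrow> nat \<Rightarrow> real" where
  "noise_coef n s z = theta_hat n (\<lambda>l. s l * z l)"

definition vol :: "nat \<Rightarrow> (nat \<Rightarrow> real) \<Rightarrow> real" where
  "vol n s = (1 / real n) * (\<Sum>l=1..n. (s l)\<^sup>2)"

definition loss :: "nat \<Rightarrow> (real \<Rightarrow> real) \<Rightarrow> (nat \<Rightarrow> real) \<Rightarrow> (nat \<Rightarrow> real) \<Rightarrow> real" where
  "loss n S y lam = emp_norm_sq n (\<lambda>x. weighted_est n y lam x - S x)"

text \<open>Up to the factor 1/n this is the smoothing matrix of \<open>weighted_est\<close> on the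
  design points.\<close>

definition kern :: "nat \<Rightarrow> (nat \<Rightarrow> real) \<Rightarrow> nat \<Rightarrow> nat \<Rightarrow> real" where
  "kern n lam l r = (\<Sum>j=1..n. lam j * trig j (design n l) * trig j (design n r))"

definition off_diag :: "nat \<Rightarrow> (nat \<Rightarrow> real) \<Rightarrow> (nat \<Rightarrow> real) \<Rightarrow> (nat \<Rightarrow> real) \<Rightarrow> real" where
  "off_diag n s z lam =
     (1 / (real n)\<^sup>2) * (\<Sum>l=1..n. \<Sum>r\<in>{1..n} - {l}. (s l * s r * kern n lam l r) * z l * z r)"

definition diag_fluct :: "nat \<Rightarrow> (nat \<Rightarrow> real) \<Rightarrow> (nat \<Rightarrow> real) \<Rightarrow> (nat \<Rightarrow> real) \<Rightarrow> real" where
  "diag_fluct n s z lam = (1 / (real n)\<^sup>2) * (\<Sum>l=1..n. ((s l)\<^sup>2 * kern n lam l l) * ((z l)\<^sup>2 - 1))"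

text \<open>The diagonal noise energy has conditional mean \<open>vol n s / real n\<close> times the
  sum of the weights plus this term. For odd n it vanishes when all volatilities are equal, because
  each \<open>trig_bar j\<close> with j in 1..n then sums to zero over the design.\<close>

definition vol_bias :: "nat \<Rightarrow> (nat \<Rightarrow> real) \<Rightarrow> (nat \<Rightarrow> real) \<Rightarrow> real" where
  "vol_bias n s w = (1 / (real n)\<^sup>2) * (\<Sum>l=1..n. (s l)\<^sup>2 * (\<Sum>j=1..n. w j * trig_bar j (design n l)))"

definition signal_noise :: "nat \<Rightarrow> (real \<Rightarrow> real) \<Rightarrow> (nat \<Rightarrow> real) \<Rightarrow> (nat \<Rightarrow> real) \<Rightarrow> (nat \<Rightarrow> real) \<Rightarrow> real" where
  "signal_noise n S s z x = (\<Sum>j=1..n. x j * fourier_coef n S j * noise_coef n s z j)"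

definition signal_energy :: "nat \<Rightarrow> (real \<Rightarrow> real) \<Rightarrow> (nat \<Rightarrow> real) \<Rightarrow> real" where
  "signal_energy n S x = (\<Sum>j=1..n. (x j * fourier_coef n S j)\<^sup>2)"

text \<open>
  The quotients left over by Young's inequality; those with a vanishing denominator are 0 and so is
  their numerator.  The penalty stands for the conditional variance of \<open>off_diag\<close>, and
  \<open>signal_energy\<close> for that of \<open>signal_noise\<close>.  The last quotient comes from
  replacing the unknown energy of the difference by its empirical version.  The factors 2 and 4
  allow the same sum to serve for both \<open>lhat\<close> and \<open>lam0\<close>.
\<close>

definition remainder ::
    "nat \<Rightarrow> (real \<Rightarrow> real) \<Rightarrow> real \<Rightarrow> (nat \<Rightarrow> real) \<Rightarrow> (nat \<Rightarrow> real) \<Rightarrow> (nat \<Rightarrow> real) \<Rightarrow> (nat \<Rightarrow> real) \<Rightarrow> real" where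
  "remainder n S \<rho> lam0 s z lam =
     (1 - \<rho>) * (2 * ((off_diag n s z lam)\<^sup>2 / (\<rho> * penalty n (vol n s) lam)) + 4 * \<bar>diag_fluct n s z lam\<bar>
       + (signal_noise n S s z (\<lambda>j. lam j - lam0 j))\<^sup>2 / (\<rho> * signal_energy n S (\<lambda>j. lam j - lam0 j)))
     + (signal_noise n S s z (\<lambda>j. (lam j - lam0 j)\<^sup>2))\<^sup>2 / signal_energy n S (\<lambda>j. lam j - lam0 j)"

lemma theta_hat_model_obs:
  "theta_hat n (model_obs n S s z) j = fourier_coef n S j + noise_coef n s z j"
  by (simp add: theta_hat_def model_obs_def fourier_coef_def noise_coef_def
      distrib_right distrib_left sum.distrib)

section \<open>Parseval, Bessel, the expansion of the loss and the noise energy\<close>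

lemma sum_rotate:
  "(\<Sum>l\<in>A. \<Sum>i\<in>B. \<Sum>j\<in>C. f l i j) = (\<Sum>i\<in>B. \<Sum>j\<in>C. \<Sum>l\<in>A. f l i j)"
proof -
  have "(\<Sum>l\<in>A. \<Sum>i\<in>B. \<Sum>j\<in>C. f l i j) = (\<Sum>i\<in>B. \<Sum>l\<in>A. \<Sum>j\<in>C. f l i j)"
    by (rule sum.swap)
  also have "\<dots> = (\<Sum>i\<in>B. \<Sum>j\<in>C. \<Sum>l\<in>A. f l i j)"
    by (intro sum.cong refl) (rule sum.swap)
  finally show ?thesis .
qed

lemma trig_parseval:
  assumes "odd n"
  shows "(\<Sum>l=1..n. (\<Sum>j=1..n. c j * trig j (design n l))\<^sup>2) = real n * (\<Sum>j=1..n. (c j)\<^sup>2)"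
proof -
  have "(\<Sum>l=1..n. (\<Sum>j=1..n. c j * trig j (design n l))\<^sup>2)
      = (\<Sum>l=1..n. \<Sum>i=1..n. \<Sum>j=1..n. c i * c j * (trig i (design n l) * trig j (design n l)))"
    by (simp add: power2_eq_square sum_product ac_simps)
  also have "\<dots> = (\<Sum>i=1..n. \<Sum>j=1..n. \<Sum>l=1..n. c i * c j * (trig i (design n l) * trig j (design n l)))"
    by (rule sum_rotate)
  also have "\<dots> = (\<Sum>i=1..n. \<Sum>j=1..n. c i * c j * (if i = j then real n else 0))"
    unfolding sum_distrib_left[symmetric]
    by (intro sum.cong refl arg_cong2[where f="(*)"] trig_orthonormal assms)
  also have "\<dots> = real n * (\<Sum>j=1..n. (c j)\<^sup>2)"
    by (simp add: if_distrib sum_distrib_left power2_eq_square ac_simps cong: if_cong)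
  finally show ?thesis .
qed

text \<open>As a function of r the kernel is a trigonometric polynomial with coefficients
  \<open>lam j * trig j (design n l)\<close>. Parseval evaluates its energy, and the factor 2 is the
  bound on the squared basis functions.\<close>

lemma sum_sq_kern:
  assumes "odd n"
  shows "(\<Sum>r=1..n. (kern n lam l r)\<^sup>2) \<le> 2 * real n * weight_norm_sq n lam"
proof -
  have "(\<Sum>r=1..n. (kern n lam l r)\<^sup>2)
      = real n * (\<Sum>j=1..n. (lam j)\<^sup>2 * (trig j (design n l))\<^sup>2)"
    unfolding kern_def trig_parseval[OF assms] by (simp add: power_mult_distrib)
  also have "\<dots> \<le> real n * (\<Sum>j=1..n. (lam j)\<^sup>2 * 2)"
    by (intro mult_left_mono sum_mono trig_sq_le_2) auto
  finally show ?thesis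
    unfolding weight_norm_sq_def sum_distrib_right[symmetric] by (simp only: ac_simps)
qed

lemma emp_norm_sq_trig_diff:
  assumes "odd n"
  shows "emp_norm_sq n (\<lambda>x. (\<Sum>j=1..n. c j * trig j x) - S x)
    = (\<Sum>j=1..n. (c j)\<^sup>2) - 2 * (\<Sum>j=1..n. c j * fourier_coef n S j) + emp_norm_sq n S"
proof -
  have n: "n \<noteq> 0" using assms by (cases n) auto
  have cross: "(\<Sum>l=1..n. (\<Sum>j=1..n. c j * trig j (design n l)) * S (design n l))
      = real n * (\<Sum>j=1..n. c j * fourier_coef n S j)"
    using n unfolding fourier_coef_def theta_hat_def sum_distrib_right sum_distrib_left
    by (subst sum.swap) (simp add: ac_simps)
  have "emp_norm_sq n (\<lambda>x. (\<Sum>j=1..n. c j * trig j x) - S x)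
    = (1 / real n) * ((\<Sum>l=1..n. (\<Sum>j=1..n. c j * trig j (design n l))\<^sup>2)
       - 2 * (\<Sum>l=1..n. (\<Sum>j=1..n. c j * trig j (design n l)) * S (design n l))
       + (\<Sum>l=1..n. (S (design n l))\<^sup>2))"
    unfolding emp_norm_sq_def emp_inner_def power2_eq_square[symmetric] power2_diff
      sum.distrib sum_subtractf by (simp add: sum_distrib_left ac_simps)
  then show ?thesis
    unfolding trig_parseval[OF assms] cross
    using n by (simp add: emp_norm_sq_def emp_inner_def power2_eq_square field_simps)
qed

lemma loss_expand:
  assumes "odd n"
  shows "loss n S y lam = (\<Sum>j=1..n. (lam j)\<^sup>2 * (theta_hat n y j)\<^sup>2)
      - 2 * (\<Sum>j=1..n. lam j * theta_hat n y j * fourier_coef n S j) + emp_norm_sq n S"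
  unfolding loss_def weighted_est_def
  using emp_norm_sq_trig_diff[OF assms, of "\<lambda>j. lam j * theta_hat n y j" S]
  by (simp add: power_mult_distrib)

text \<open>The residual of the projection of S has nonnegative squared norm.\<close>

lemma trig_bessel:
  assumes "odd n"
  shows "(\<Sum>j=1..n. (fourier_coef n S j)\<^sup>2) \<le> emp_norm_sq n S"
proof -
  have "0 \<le> emp_norm_sq n (\<lambda>x. (\<Sum>j=1..n. fourier_coef n S j * trig j x) - S x)"
    by (simp add: emp_norm_sq_def emp_inner_def sum_nonneg)
  then show ?thesis
    unfolding emp_norm_sq_trig_diff[OF assms] by (simp add: power2_eq_square)
qed

text \<open>The gap between the two sides is the energy of S outside the span of the basis,
  nonnegative by Bessel.\<close>

lemma loss_ge_coef_loss:
  assumes "odd n"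
  shows "(\<Sum>j=1..n. (lam j * theta_hat n y j - fourier_coef n S j)\<^sup>2) \<le> loss n S y lam"
  using trig_bessel[OF assms, of S] unfolding loss_expand[OF assms]
  by (simp add: power2_diff sum.distrib sum_subtractf power_mult_distrib sum_distrib_left ac_simps)

lemma loss_nonneg: "0 \<le> loss n S y lam"
  by (simp add: loss_def emp_norm_sq_def emp_inner_def sum_nonneg)

lemma kern_diag: "kern n w l l = (\<Sum>j=1..n. w j) + (\<Sum>j=1..n. w j * trig_bar j (design n l))"
  by (simp add: kern_def trig_bar_def sum.distrib[symmetric] power2_eq_square algebra_simps)

text \<open>The square expands into a double sum over design points. Its off-diagonal part is
  \<open>off_diag\<close>; on the diagonal, z^2 = (z^2 - 1) + 1 separates the fluctuation from its
  mean, and \<open>kern_diag\<close> splits that mean into the equal-volatility value and the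
  bias.\<close>

lemma weighted_noise_energy:
  assumes "n > 0"
  shows "(\<Sum>j=1..n. w j * (noise_coef n s z j)\<^sup>2)
    = off_diag n s z w + diag_fluct n s z w + (vol n s / real n * (\<Sum>j=1..n. w j) + vol_bias n s w)"
proof -
  define a where "a = (\<lambda>l r. (s l * s r * kern n w l r) * z l * z r)"
  have "(\<Sum>j=1..n. w j * (noise_coef n s z j)\<^sup>2)
      = (\<Sum>j=1..n. (1 / (real n)\<^sup>2) * (\<Sum>l=1..n. \<Sum>r=1..n.
          w j * (s l * z l * trig j (design n l)) * (s r * z r * trig j (design n r))))"
    by (simp add: noise_coef_def theta_hat_def power_mult_distrib power_divide)
       (simp add: power2_eq_square sum_product sum_distrib_left sum_divide_distrib ac_simps)
  also have "\<dots> = (1 / (real n)\<^sup>2) * (\<Sum>l=1..n. \<Sum>r=1..n. \<Sum>j=1..n.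
          w j * (s l * z l * trig j (design n l)) * (s r * z r * trig j (design n r)))"
    by (subst sum_distrib_left[symmetric], rule arg_cong2[where f="(*)"], rule refl, rule sum_rotate)
  also have "\<dots> = (1 / (real n)\<^sup>2) * (\<Sum>l=1..n. \<Sum>r=1..n. a l r)"
    by (simp add: a_def kern_def sum_distrib_left sum_distrib_right ac_simps)
  also have "(\<Sum>l=1..n. \<Sum>r=1..n. a l r) = (\<Sum>l=1..n. a l l + (\<Sum>r\<in>{1..n} - {l}. a l r))"
    by (intro sum.cong refl sum.remove) auto
  also have "\<dots> = (\<Sum>l=1..n. ((s l)\<^sup>2 * kern n w l l) * ((z l)\<^sup>2 - 1)) + (\<Sum>l=1..n. (s l)\<^sup>2 * kern n w l l)
        + (\<Sum>l=1..n. \<Sum>r\<in>{1..n} - {l}. a l r)"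
    by (simp add: sum.distrib[symmetric] a_def power2_eq_square algebra_simps)
  also have "(\<Sum>l=1..n. (s l)\<^sup>2 * kern n w l l)
      = real n * vol n s * (\<Sum>j=1..n. w j) + (\<Sum>l=1..n. (s l)\<^sup>2 * (\<Sum>j=1..n. w j * trig_bar j (design n l)))"
    using assms by (simp only: kern_diag distrib_left sum.distrib sum_distrib_right[symmetric]) (simp add: vol_def)
  finally show ?thesis
    using assms
    by (simp add: a_def off_diag_def diag_fluct_def vol_bias_def distrib_left power2_eq_square)
qed

lemma loss_comparison:
  assumes n: "odd n" and opt: "cost n \<rho> (model_obs n S s z) v lam \<le> cost n \<rho> (model_obs n S s z) v lam0"
  shows "loss n S (model_obs n S s z) lam \<le> loss n S (model_obs n S s z) lam0
    + 2 * signal_noise n S s z (\<lambda>j. lam j - lam0 j)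
    + 2 * (off_diag n s z lam - off_diag n s z lam0) + 2 * (diag_fluct n s z lam - diag_fluct n s z lam0)
    + 2 * (vol_bias n s lam - vol_bias n s lam0)
    + 2 * ((vol n s - v) / real n * ((\<Sum>j=1..n. lam j) - (\<Sum>j=1..n. lam0 j)))
    + \<rho> * (penalty n v lam0 - penalty n v lam)"
proof -
  have pos: "n > 0" using n by (cases n) auto
  define y where "y = model_obs n S s z"
  \<comment> \<open>Loss and cost differ in their linear term: the loss has the estimated times the
    true coefficient where the cost has \<open>theta_tilde\<close>. Since the estimate is truth plus
    noise, the difference is truth times noise, plus squared noise, minus v/n.\<close>
  have id: "loss n S y w = cost n \<rho> y v w + 2 * ((\<Sum>j=1..n. w j * fourier_coef n S j * noise_coef n s z j)
      + (\<Sum>j=1..n. w j * (noise_coef n s z j)\<^sup>2) - v / real n * (\<Sum>j=1..n. w j))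
      + emp_norm_sq n S - \<rho> * penalty n v w" for w
  proof -
    have "w j * theta_tilde n y v j - w j * theta_hat n y j * fourier_coef n S j
        = w j * fourier_coef n S j * noise_coef n s z j + w j * (noise_coef n s z j)\<^sup>2 - v / real n * w j" for j
      by (simp add: theta_tilde_def y_def theta_hat_model_obs power2_eq_square algebra_simps)
    then have eq: "(\<Sum>j=1..n. w j * theta_tilde n y v j) - (\<Sum>j=1..n. w j * theta_hat n y j * fourier_coef n S j)
        = (\<Sum>j=1..n. w j * fourier_coef n S j * noise_coef n s z j)
      + (\<Sum>j=1..n. w j * (noise_coef n s z j)\<^sup>2) - v / real n * (\<Sum>j=1..n. w j)"
      unfolding sum_subtractf[symmetric] sum.distrib[symmetric] sum_distrib_left by simp
    show ?thesis
      unfolding loss_expand[OF n] cost_def eq[symmetric] by (simp add: right_diff_distrib)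
  qed
  have sn: "signal_noise n S s z (\<lambda>j. lam j - lam0 j)
      = (\<Sum>j=1..n. lam j * fourier_coef n S j * noise_coef n s z j)
        - (\<Sum>j=1..n. lam0 j * fourier_coef n S j * noise_coef n s z j)"
    by (simp add: signal_noise_def sum_subtractf[symmetric] algebra_simps)
  \<comment> \<open>With these products opaque, the remaining claim is linear in the named
    quantities.\<close>
  obtain p q where pq: "\<And>w. vol n s / real n * (\<Sum>j=1..n. w j) = p w"
      "\<And>w. v / real n * (\<Sum>j=1..n. w j) = q w"
    by (rule that) (rule refl)+
  have D: "(vol n s - v) / real n * ((\<Sum>j=1..n. lam j) - (\<Sum>j=1..n. lam0 j))
     = p lam - p lam0 - q lam + q lam0"
    unfolding pq[symmetric] by (simp add: algebra_simps diff_divide_distrib)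
  show ?thesis
    using opt id[of lam] id[of lam0] weighted_noise_energy[OF pos, of lam s z] weighted_noise_energy[OF pos, of lam0 s z]
    unfolding y_def pq D sn right_diff_distrib[of \<rho>] by argo
qed

text \<open>AM-GM with weight \<rho> t. For t = 0 the quotient is 0 by the convention on division,
  which is why u must vanish there as well.\<close>

lemma young_ineq:
  fixes u t \<rho> :: real
  assumes "0 < \<rho>" "0 \<le> t" "t = 0 \<Longrightarrow> u = 0"
  shows "2 * \<bar>u\<bar> \<le> \<rho> * t + u\<^sup>2 / (\<rho> * t)"
proof (cases "t = 0")
  case False
  then have pos: "0 < \<rho> * t" using assms by simp
  have "2 * \<bar>u\<bar> * (\<rho> * t) \<le> (\<rho> * t)\<^sup>2 + u\<^sup>2"
    using sum_squares_bound[of "\<bar>u\<bar>" "\<rho> * t"] by (simp add: ac_simps)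
  then have "2 * \<bar>u\<bar> \<le> ((\<rho> * t)\<^sup>2 + u\<^sup>2) / (\<rho> * t)"
    using pos by (simp add: pos_le_divide_eq)
  also have "\<dots> = \<rho> * t + u\<^sup>2 / (\<rho> * t)"
    using pos by (simp add: add_divide_distrib power2_eq_square)
  finally show ?thesis .
qed (use assms in simp)

section \<open>Bounds uniform over the weights, and the pathwise inequality\<close>

lemma weight_sum_le_max:
  "finite \<Lambda> \<Longrightarrow> lam \<in> \<Lambda> \<Longrightarrow> (\<Sum>j=1..n. lam j) \<le> weight_sum_max n \<Lambda>"
  unfolding weight_sum_max_def by (rule Max_ge) auto

lemma weight_trig_le_max:
  assumes "finite \<Lambda>" "lam \<in> \<Lambda>" "x \<in> {0..1}"
  shows "\<bar>\<Sum>j=1..n. lam j ^ i * trig_bar j x\<bar> \<le> weight_trig_max i n \<Lambda>"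
proof -
  \<comment> \<open>A crude bound, uniform in x: a real supremum dominates its members only if the
    set is bounded above.\<close>
  have "\<bar>\<Sum>j=1..n. lam j ^ i * trig_bar j x\<bar> \<le> (\<Sum>j=1..n. \<bar>lam j ^ i\<bar>)" for x
    by (rule sum_abs[THEN order_trans], rule sum_mono)
       (simp add: abs_mult mult_left_le abs_trig_bar_le_1)
  then have "bdd_above ((\<lambda>x. \<bar>\<Sum>j=1..n. lam j ^ i * trig_bar j x\<bar>) ` {0..1})"
    by (intro bdd_aboveI2)
  then have "\<bar>\<Sum>j=1..n. lam j ^ i * trig_bar j x\<bar>
      \<le> (SUP x\<in>{0..1}. \<bar>\<Sum>j=1..n. lam j ^ i * trig_bar j x\<bar>)"
    using assms by (intro cSUP_upper)
  also have "\<dots> \<le> weight_trig_max i n \<Lambda>"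
    unfolding weight_trig_max_def using assms by (intro Max_ge) auto
  finally show ?thesis .
qed

text \<open>The weight is left general: it is used for a weight vector in the pathwise comparison
  and for its squares in the lower bound on the mean loss.\<close>

lemma abs_vol_bias_le:
  assumes "n > 0" "\<And>l. l \<in> {1..n} \<Longrightarrow> (s l)\<^sup>2 \<le> b"
    and "\<And>x. x \<in> {0..1} \<Longrightarrow> \<bar>\<Sum>j=1..n. w j * trig_bar j x\<bar> \<le> c"
  shows "\<bar>vol_bias n s w\<bar> \<le> c * b / real n"
proof -
  have c: "0 \<le> c" using assms(3)[of 0] by simp
  have "\<bar>\<Sum>l=1..n. (s l)\<^sup>2 * (\<Sum>j=1..n. w j * trig_bar j (design n l))\<bar> \<le> (\<Sum>l=1..n. b * c)"
  proof (rule sum_abs[THEN order_trans], rule sum_mono)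
    fix l assume l: "l \<in> {1..n}"
    then have "design n l \<in> {0..1}" by (simp add: design_def)
    then show "\<bar>(s l)\<^sup>2 * (\<Sum>j=1..n. w j * trig_bar j (design n l))\<bar> \<le> b * c"
      unfolding abs_mult using assms(2)[OF l] assms(3) c
      by (intro mult_mono) (auto intro: order_trans[OF zero_le_power2])
  qed
  then show ?thesis
    using assms(1) unfolding vol_bias_def abs_mult
    by (simp add: power2_eq_square field_simps)
qed

text \<open>A deterministic statement for one outcome: \<open>lam\<close> may be any function of the
  data and \<open>v\<close> any real number. The right-hand side no longer contains
  \<open>lam\<close>, apart from its role as a summation variable.\<close>

lemma pathwise_oracle_inequality:
  assumes n: "odd n" and \<rho>: "0 < \<rho>" "\<rho> < 1 / 3"
    and \<Lambda>: "\<Lambda> \<subseteq> {1..n} \<rightarrow>\<^sub>E {0..1}" "finite \<Lambda>"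
    and lam: "lam \<in> \<Lambda>" and lam0: "lam0 \<in> \<Lambda>"
    and s: "\<And>l. l \<in> {1..n} \<Longrightarrow> 0 < s l" "\<And>l. l \<in> {1..n} \<Longrightarrow> (s l)\<^sup>2 \<le> b"
    and opt: "cost n \<rho> (model_obs n S s z) v lam \<le> cost n \<rho> (model_obs n S s z) v lam0"
  shows "(1 - 3 * \<rho>) * loss n S (model_obs n S s z) lam \<le> (1 + \<rho>) * loss n S (model_obs n S s z) lam0
     + 2 * \<rho> * (1 - \<rho>) * penalty n (vol n s) lam0 + (\<Sum>lam\<in>\<Lambda>. remainder n S \<rho> lam0 s z lam)
     + (1 - \<rho>) * (4 * (weight_trig_max 1 n \<Lambda> * b / real n))
     + 2 * (1 - \<rho>\<^sup>2) * weight_sum_max n \<Lambda> * \<bar>v - vol n s\<bar> / real n"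
proof -
  have pos: "n > 0" using n by (cases n) auto
  define y where "y = model_obs n S s z"
  define R where "R = weight_sum_max n \<Lambda>"
  define \<delta> where "\<delta> = \<bar>v - vol n s\<bar> / real n"
  have \<delta>: "0 \<le> \<delta>" by (simp add: \<delta>_def)
  have range: "w j \<in> {0..1}" if "w \<in> \<Lambda>" "j \<in> {1..n}" for w j
    using \<Lambda>(1) that by blast
  have sumR: "0 \<le> (\<Sum>j=1..n. w j)" "(\<Sum>j=1..n. w j) \<le> R" if "w \<in> \<Lambda>" for w
    using that range weight_sum_le_max[OF \<Lambda>(2) that] by (auto simp: R_def intro!: sum_nonneg)
  \<comment> \<open>Weights in [0, 1] dominate their squares, so one bound R serves both for weight
    sums and for the factor in the penalty.\<close>
  have sqR: "0 \<le> weight_norm_sq n w" "weight_norm_sq n w \<le> R" if "w \<in> \<Lambda>" for w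
  proof -
    have "weight_norm_sq n w \<le> (\<Sum>j=1..n. w j)"
      unfolding weight_norm_sq_def power2_eq_square
      using range[OF that] by (intro sum_mono) (simp add: mult_left_le)
    then show "0 \<le> weight_norm_sq n w" "weight_norm_sq n w \<le> R"
      using sumR[OF that] by (auto simp: weight_norm_sq_def intro: sum_nonneg)
  qed
  have vpos: "0 < vol n s"
  proof -
    have "0 < (\<Sum>l=1..n. (s l)\<^sup>2)"
      using pos s(1) by (intro sum_pos zero_less_power) auto
    then show ?thesis using pos by (simp add: vol_def)
  qed
  define x where "x = (\<lambda>j. lam j - lam0 j)"
  define T where "T = signal_energy n S x"
  define U where "U = (\<Sum>j=1..n. (x j * theta_hat n y j)\<^sup>2)"
  have T0: "0 \<le> T" by (simp add: T_def signal_energy_def sum_nonneg)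
  have xT: "x j * fourier_coef n S j = 0" if "T = 0" "j \<in> {1..n}" for j
    using that by (auto simp: T_def signal_energy_def sum_nonneg_eq_0_iff)
  \<comment> \<open>The cost penalizes with \<open>v\<close>, which may be far off or negative,
    whereas Young's inequality needs the penalty with the true mean volatility.\<close>
  have pen: "\<bar>penalty n v w - penalty n (vol n s) w\<bar> \<le> R * \<delta>" if "w \<in> \<Lambda>" for w
  proof -
    have "\<bar>penalty n v w - penalty n (vol n s) w\<bar> = weight_norm_sq n w * \<delta>"
      using sqR[OF that]
      by (simp add: penalty_def \<delta>_def diff_divide_distrib[symmetric] right_diff_distrib[symmetric] abs_mult)
    then show ?thesis using sqR(2)[OF that] \<delta> by (simp add: mult_right_mono)
  qed
  have off: "2 * \<bar>off_diag n s z w\<bar> \<le> \<rho> * penalty n (vol n s) w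
      + (off_diag n s z w)\<^sup>2 / (\<rho> * penalty n (vol n s) w)" if "w \<in> \<Lambda>" for w
  proof (rule young_ineq)
    show "0 \<le> penalty n (vol n s) w"
      \<comment> \<open>If the penalty vanishes, positivity of the mean volatility forces all
        weights to be zero, and the quadratic form vanishes too.\<close>
      using sqR[OF that] vpos by (simp add: penalty_def)
    assume "penalty n (vol n s) w = 0"
    then have "weight_norm_sq n w = 0" using vpos pos by (simp add: penalty_def)
    then have "w j = 0" if "j \<in> {1..n}" for j
      using that by (auto simp: weight_norm_sq_def sum_nonneg_eq_0_iff)
    then show "off_diag n s z w = 0" by (simp add: off_diag_def kern_def)
  qed fact
  have Z1: "2 * \<bar>signal_noise n S s z x\<bar> \<le> \<rho> * T + (signal_noise n S s z x)\<^sup>2 / (\<rho> * T)"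
    by (rule young_ineq[OF \<rho>(1) T0]) (simp add: signal_noise_def xT)
  have Z2: "2 * \<bar>signal_noise n S s z (\<lambda>j. (x j)\<^sup>2)\<bar>
      \<le> \<rho> * T + (signal_noise n S s z (\<lambda>j. (x j)\<^sup>2))\<^sup>2 / (\<rho> * T)"
    by (rule young_ineq[OF \<rho>(1) T0]) (auto simp: signal_noise_def power2_eq_square intro!: sum.neutral dest: xT)
  \<comment> \<open>U is T with estimated coefficients in place of the true ones. Expanding it, the
    squared noise is dropped as nonnegative.\<close>
  have U1: "T + 2 * signal_noise n S s z (\<lambda>j. (x j)\<^sup>2) \<le> U"
  proof -
    have "U = T + 2 * signal_noise n S s z (\<lambda>j. (x j)\<^sup>2) + (\<Sum>j=1..n. (x j)\<^sup>2 * (noise_coef n s z j)\<^sup>2)"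
      unfolding U_def T_def signal_energy_def signal_noise_def sum_distrib_left sum.distrib[symmetric]
      by (intro sum.cong refl) (simp add: y_def theta_hat_model_obs power2_eq_square algebra_simps)
    then show ?thesis by (simp add: sum_nonneg)
  qed
  \<comment> \<open>Both weighted estimates are compared with the true coefficients; this is the
    source of the two factors 2.\<close>
  have U2: "U \<le> 2 * loss n S y lam + 2 * loss n S y lam0"
  proof -
    have "(p - q)\<^sup>2 \<le> 2 * (p - r)\<^sup>2 + 2 * (q - r)\<^sup>2" for p q r :: real
      using zero_le_power2[of "(p - r) + (q - r)"] by (simp add: power2_eq_square algebra_simps)
    then have "U \<le> (\<Sum>j=1..n. 2 * (lam j * theta_hat n y j - fourier_coef n S j)\<^sup>2
        + 2 * (lam0 j * theta_hat n y j - fourier_coef n S j)\<^sup>2)"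
      unfolding U_def x_def left_diff_distrib by (intro sum_mono)
    also have "\<dots> = 2 * (\<Sum>j=1..n. (lam j * theta_hat n y j - fourier_coef n S j)\<^sup>2)
        + 2 * (\<Sum>j=1..n. (lam0 j * theta_hat n y j - fourier_coef n S j)\<^sup>2)"
      by (simp add: sum.distrib sum_distrib_left)
    finally show ?thesis
      using loss_ge_coef_loss[OF n, of lam y S] loss_ge_coef_loss[OF n, of lam0 y S] by linarith
  qed
  have bias: "\<bar>vol_bias n s w\<bar> \<le> weight_trig_max 1 n \<Lambda> * b / real n" if "w \<in> \<Lambda>" for w
    by (rule abs_vol_bias_le[OF pos s(2)])
       (use weight_trig_le_max[OF \<Lambda>(2) that, where i=1 and n=n] in \<open>simp_all only: power_one_right\<close>)
  define D where "D = (vol n s - v) / real n * ((\<Sum>j=1..n. lam j) - (\<Sum>j=1..n. lam0 j))"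
  have D: "\<bar>D\<bar> \<le> R * \<delta>"
  proof -
    \<comment> \<open>Both sums lie in [0, R], so their difference costs R and not 2 R.\<close>
    have "\<bar>(\<Sum>j=1..n. lam j) - (\<Sum>j=1..n. lam0 j)\<bar> \<le> R"
      using sumR[OF lam] sumR[OF lam0] by linarith
    then show ?thesis
      using \<delta> by (simp add: D_def \<delta>_def abs_mult abs_minus_commute[of v] mult_left_mono divide_right_mono mult.commute[of R])
  qed
  define E where "E = loss n S y lam"
  define E0 where "E0 = loss n S y lam0"
  define B where "B = weight_trig_max 1 n \<Lambda> * b / real n"
  define Pen0 where "Pen0 = penalty n (vol n s) lam0"
  define f where "f = (\<lambda>w. (off_diag n s z w)\<^sup>2 / (\<rho> * penalty n (vol n s) w) + 2 * \<bar>diag_fluct n s z w\<bar>)"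
  define g1 where "g1 = (\<lambda>w. (signal_noise n S s z (\<lambda>j. w j - lam0 j))\<^sup>2
      / (\<rho> * signal_energy n S (\<lambda>j. w j - lam0 j)))"
  define g2 where "g2 = (\<lambda>w. (signal_noise n S s z (\<lambda>j. (w j - lam0 j)\<^sup>2))\<^sup>2
      / signal_energy n S (\<lambda>j. w j - lam0 j))"
  define X where "X = g1 lam + f lam + f lam0 + 4 * B + 2 * (\<rho> * Pen0) + 2 * (R * \<delta>) + 2 * (\<rho> * (R * \<delta>))"
  \<comment> \<open>The penalty of \<open>lam\<close> created by Young's inequality is cancelled by
    the one in the cost. For \<open>lam0\<close> the two add up, whence 2 \<rho> \<open>Pen0\<close>
    in X.\<close>
  have "E \<le> E0 + \<rho> * T + X"
  proof -
    have "\<rho> * (penalty n v lam0 - penalty n v lam)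
        \<le> \<rho> * (Pen0 + R * \<delta> - penalty n (vol n s) lam + R * \<delta>)"
      using pen[OF lam] pen[OF lam0] \<rho>(1) unfolding Pen0_def by (intro mult_left_mono) linarith+
    also have "\<dots> = \<rho> * Pen0 - \<rho> * penalty n (vol n s) lam + 2 * (\<rho> * (R * \<delta>))"
      by (simp add: algebra_simps)
    finally show ?thesis
      using loss_comparison[OF n opt, folded D_def] off[OF lam] off[OF lam0]
        bias[OF lam, THEN abs_le_D1] bias[OF lam0, THEN abs_le_D2] D[THEN abs_le_D1] Z1
      unfolding X_def f_def g1_def E_def E0_def B_def Pen0_def T_def x_def y_def by argo
  qed
  then have "(1 - \<rho>) * E \<le> (1 - \<rho>) * (E0 + \<rho> * T + X)"
    using \<rho> by (intro mult_left_mono) auto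
  moreover have "\<rho> * ((1 - \<rho>) * T) \<le> \<rho> * (2 * E + 2 * E0 + g2 lam / \<rho>)"
  proof (rule mult_left_mono)
    have "g2 lam / \<rho> = (signal_noise n S s z (\<lambda>j. (x j)\<^sup>2))\<^sup>2 / (\<rho> * T)"
      by (simp add: g2_def x_def T_def mult.commute)
    then show "(1 - \<rho>) * T \<le> 2 * E + 2 * E0 + g2 lam / \<rho>"
      using Z2 U1 U2 unfolding E_def E0_def left_diff_distrib by linarith
  qed (use \<rho> in simp)
  ultimately have main: "(1 - 3 * \<rho>) * E \<le> (1 + \<rho>) * E0 + g2 lam + (1 - \<rho>) * X"
    using \<rho> by (simp add: algebra_simps)
  have penpos: "0 \<le> penalty n (vol n s) w" if "w \<in> \<Lambda>" for w
    using sqR[OF that] vpos by (simp add: penalty_def)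
  have f: "0 \<le> f w" if "w \<in> \<Lambda>" for w
    using \<rho> penpos[OF that] by (simp add: f_def)
  have se: "0 \<le> signal_energy n S w" for w
    by (simp add: signal_energy_def sum_nonneg)
  have g: "0 \<le> g1 w" "0 \<le> g2 w" for w
    using \<rho> se by (simp_all add: g1_def g2_def)
  have rem: "remainder n S \<rho> lam0 s z w = (1 - \<rho>) * (2 * f w + g1 w) + g2 w" for w
    by (simp add: remainder_def f_def g1_def g2_def)
  have "(1 - \<rho>) * (f lam + f lam0 + g1 lam) + g2 lam \<le> (1 - \<rho>) * (2 * sum f \<Lambda> + sum g1 \<Lambda>) + sum g2 \<Lambda>"
    using \<rho> f g member_le_sum[OF lam, of f] member_le_sum[OF lam0, of f] member_le_sum[OF lam, of g1]
      member_le_sum[OF lam, of g2] \<Lambda>(2) by (intro add_mono mult_left_mono) auto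
  also have "\<dots> = (\<Sum>lam\<in>\<Lambda>. remainder n S \<rho> lam0 s z lam)"
    by (simp add: rem sum.distrib sum_distrib_left distrib_left)
  finally have "g2 lam + (1 - \<rho>) * X \<le> (\<Sum>lam\<in>\<Lambda>. remainder n S \<rho> lam0 s z lam)
      + (1 - \<rho>) * (4 * B + 2 * (\<rho> * Pen0) + 2 * (R * \<delta>) + 2 * (\<rho> * (R * \<delta>)))"
    unfolding X_def by (simp add: algebra_simps)
  also have "\<dots> = (\<Sum>lam\<in>\<Lambda>. remainder n S \<rho> lam0 s z lam) + (1 - \<rho>) * (4 * B)
      + 2 * \<rho> * (1 - \<rho>) * Pen0 + 2 * (1 - \<rho>\<^sup>2) * R * \<delta>"
    by (simp add: algebra_simps power2_eq_square)
  finally show ?thesis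
    using main unfolding E_def E0_def B_def Pen0_def R_def \<delta>_def y_def
    by (simp add: mult.assoc)
qed

section \<open>Moment bounds for fixed volatilities\<close>

lemma signal_energy_nonneg: "0 \<le> signal_energy n S x"
  by (simp add: signal_energy_def sum_nonneg)

lemma noise_coef_linear: "noise_coef n s z j = (\<Sum>l=1..n. (s l * trig j (design n l) / real n) * z l)"
  by (simp add: noise_coef_def theta_hat_def sum_distrib_left ac_simps)

text \<open>The coefficient of z at l is s/n times the value at the design point of a trigonometric
  polynomial, the form in which Parseval bounds the variance.\<close>

lemma signal_noise_linear:
  "signal_noise n S s z w
    = (\<Sum>l=1..n. (s l / real n * (\<Sum>j=1..n. (w j * fourier_coef n S j) * trig j (design n l))) * z l)"
  unfolding signal_noise_def noise_coef_linear sum_distrib_left sum_distrib_right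
  by (subst sum.swap) (simp add: ac_simps)

text \<open>Independence is stated for families restricted to 1..n, which are undefined elsewhere;
  these congruences allow passing between restricted and unrestricted vectors.\<close>

lemma remainder_cong:
  assumes "\<And>l. l \<in> {1..n} \<Longrightarrow> s l = s' l" "\<And>l. l \<in> {1..n} \<Longrightarrow> z l = z' l"
  shows "remainder n S \<rho> lam0 s z = remainder n S \<rho> lam0 s' z'"
    and "loss n S (model_obs n S s z) lam = loss n S (model_obs n S s' z') lam"
    and "penalty n (vol n s) lam = penalty n (vol n s') lam"
proof -
  have 1: "off_diag n s z lam = off_diag n s' z' lam" for lam
    using assms unfolding off_diag_def by (intro arg_cong2[where f="(*)"] refl sum.cong) auto
  have 2: "diag_fluct n s z lam = diag_fluct n s' z' lam" for lam
    using assms unfolding diag_fluct_def by (intro arg_cong2[where f="(*)"] refl sum.cong) auto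
  have 3: "noise_coef n s z = noise_coef n s' z'"
    using assms unfolding noise_coef_def theta_hat_def fun_eq_iff
    by (intro allI arg_cong2[where f="(*)"] refl sum.cong) auto
  have 4: "vol n s = vol n s'"
    using assms unfolding vol_def by (intro arg_cong2[where f="(*)"] refl sum.cong) auto
  show "remainder n S \<rho> lam0 s z = remainder n S \<rho> lam0 s' z'"
    unfolding fun_eq_iff remainder_def signal_noise_def 1 2 3 4 by simp
  show "loss n S (model_obs n S s z) lam = loss n S (model_obs n S s' z') lam"
    unfolding loss_def weighted_est_def theta_hat_model_obs 3 ..
  show "penalty n (vol n s) lam = penalty n (vol n s') lam"
    unfolding 4 ..
qed

context heteroscedastic_regression
begin

lemma noise_measurable: "l \<in> {1..n} \<Longrightarrow> \<xi> l \<in> borel_measurable M"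
  using noise_indep by (auto simp: indep_vars_def)

lemma noise_transfer:
  assumes j: "j \<in> {1..n}" and f: "f \<in> borel_measurable borel"
  shows "integrable M (\<lambda>\<omega>. f (\<xi> j \<omega>) :: real) \<longleftrightarrow> integrable M (\<lambda>\<omega>. f (\<xi> 1 \<omega>))"
    and "expectation (\<lambda>\<omega>. f (\<xi> j \<omega>) :: real) = expectation (\<lambda>\<omega>. f (\<xi> 1 \<omega>))"
proof -
  have m: "\<xi> j \<in> borel_measurable M" "\<xi> 1 \<in> borel_measurable M"
    using j by (auto intro: noise_measurable)
  show "integrable M (\<lambda>\<omega>. f (\<xi> j \<omega>)) \<longleftrightarrow> integrable M (\<lambda>\<omega>. f (\<xi> 1 \<omega>))"
    using integrable_distr_eq[OF m(1) f] integrable_distr_eq[OF m(2) f] noise_ident[OF j] by simp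
  show "expectation (\<lambda>\<omega>. f (\<xi> j \<omega>)) = expectation (\<lambda>\<omega>. f (\<xi> 1 \<omega>))"
    using integral_distr[OF m(1) f] integral_distr[OF m(2) f] noise_ident[OF j] by simp
qed

lemma noise_moments:
  assumes j: "j \<in> {1..n}"
  shows "expectation (\<xi> j) = 0" "expectation (\<lambda>\<omega>. (\<xi> j \<omega>)\<^sup>2) = 1"
    "integrable M (\<lambda>\<omega>. (\<xi> j \<omega>)\<^sup>2)" "integrable M (\<xi> j)"
    "integrable M (\<lambda>\<omega>. ((\<xi> j \<omega>)\<^sup>2 - 1)\<^sup>2)" "expectation (\<lambda>\<omega>. (\<xi> j \<omega>)\<^sup>2 - 1) = 0"
    "expectation (\<lambda>\<omega>. ((\<xi> j \<omega>)\<^sup>2 - 1)\<^sup>2) = \<xi>star - 1"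
proof -
  have [measurable]: "\<xi> j \<in> borel_measurable M"
    using j by (rule noise_measurable)
  show "expectation (\<xi> j) = 0"
    using noise_transfer(2)[OF j, of "\<lambda>x. x"] noise_mean by simp
  show 2: "expectation (\<lambda>\<omega>. (\<xi> j \<omega>)\<^sup>2) = 1"
    using noise_transfer(2)[OF j, of "\<lambda>x. x\<^sup>2"] noise_var by simp
  have 4: "integrable M (\<lambda>\<omega>. (\<xi> j \<omega>) ^ 4)" "expectation (\<lambda>\<omega>. (\<xi> j \<omega>) ^ 4) = \<xi>star"
    using noise_transfer[OF j, of "\<lambda>x. x ^ 4"] noise_fourth noise_fourth_finite by simp_all
  show i2: "integrable M (\<lambda>\<omega>. (\<xi> j \<omega>)\<^sup>2)"
    by (rule square_integrable_imp_abs(1)) (use 4 in \<open>simp_all add: power_mult[symmetric]\<close>)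
  then show "integrable M (\<xi> j)"
    by (rule square_integrable_imp_abs(1)[rotated]) simp
  have eq: "((\<xi> j \<omega>)\<^sup>2 - 1)\<^sup>2 = (\<xi> j \<omega>) ^ 4 - 2 * (\<xi> j \<omega>)\<^sup>2 + 1" for \<omega>
    by (simp add: power2_diff power_mult[symmetric])
  show "integrable M (\<lambda>\<omega>. ((\<xi> j \<omega>)\<^sup>2 - 1)\<^sup>2)" "expectation (\<lambda>\<omega>. (\<xi> j \<omega>)\<^sup>2 - 1) = 0"
    "expectation (\<lambda>\<omega>. ((\<xi> j \<omega>)\<^sup>2 - 1)\<^sup>2) = \<xi>star - 1"
    unfolding eq using 2 4 i2 by (simp_all add: prob_space)
qed

lemma fourth_moment_ge_1: "1 \<le> \<xi>star" if "n > 0"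
proof -
  have "0 \<le> expectation (\<lambda>\<omega>. ((\<xi> 1 \<omega>)\<^sup>2 - 1)\<^sup>2)" by simp
  also have "\<dots> = \<xi>star - 1" using noise_moments(7)[of 1] that by simp
  finally show ?thesis by simp
qed

lemma noise_linear_form:
  shows "integrable M (\<lambda>\<omega>. (\<Sum>l=1..n. c l * \<xi> l \<omega>)\<^sup>2)"
    and "expectation (\<lambda>\<omega>. (\<Sum>l=1..n. c l * \<xi> l \<omega>)\<^sup>2) = (\<Sum>l=1..n. (c l)\<^sup>2)"
    and "integrable M (\<lambda>\<omega>. \<Sum>l=1..n. c l * \<xi> l \<omega>)"
    and "expectation (\<lambda>\<omega>. \<Sum>l=1..n. c l * \<xi> l \<omega>) = 0"
proof -
  show "integrable M (\<lambda>\<omega>. (\<Sum>l=1..n. c l * \<xi> l \<omega>)\<^sup>2)"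
    "expectation (\<lambda>\<omega>. (\<Sum>l=1..n. c l * \<xi> l \<omega>)\<^sup>2) = (\<Sum>l=1..n. (c l)\<^sup>2)"
    using second_moment_linear_form[OF noise_indep _ subset_refl, of 1 c] noise_moments(1-3) by simp_all
  have int: "integrable M (\<lambda>\<omega>. c l * \<xi> l \<omega>)" if "l \<in> {1..n}" for l
    using noise_moments(4)[OF that] by simp
  then show "integrable M (\<lambda>\<omega>. \<Sum>l=1..n. c l * \<xi> l \<omega>)"
    by (rule Bochner_Integration.integrable_sum)
  show "expectation (\<lambda>\<omega>. \<Sum>l=1..n. c l * \<xi> l \<omega>) = 0"
    using int noise_moments(1) by (subst Bochner_Integration.integral_sum) auto
qed

lemma second_moment_signal_noise:
  assumes n: "odd n" and s: "\<And>l. l \<in> {1..n} \<Longrightarrow> (s l)\<^sup>2 \<le> b"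
  shows "integrable M (\<lambda>\<omega>. (signal_noise n S s (\<lambda>l. \<xi> l \<omega>) w)\<^sup>2)"
    and "expectation (\<lambda>\<omega>. (signal_noise n S s (\<lambda>l. \<xi> l \<omega>) w)\<^sup>2) \<le> b / real n * signal_energy n S w"
proof -
  have pos: "n > 0" using n by (cases n) auto
  let ?h = "\<lambda>l. \<Sum>j=1..n. (w j * fourier_coef n S j) * trig j (design n l)"
  show "integrable M (\<lambda>\<omega>. (signal_noise n S s (\<lambda>l. \<xi> l \<omega>) w)\<^sup>2)"
    unfolding signal_noise_linear by (rule noise_linear_form)
  have "expectation (\<lambda>\<omega>. (signal_noise n S s (\<lambda>l. \<xi> l \<omega>) w)\<^sup>2)
      = (\<Sum>l=1..n. (s l / real n * ?h l)\<^sup>2)"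
    unfolding signal_noise_linear by (rule noise_linear_form)
  also have "\<dots> \<le> (\<Sum>l=1..n. b / (real n)\<^sup>2 * (?h l)\<^sup>2)"
    using s by (intro sum_mono) (auto simp: power_mult_distrib power_divide intro!: mult_right_mono divide_right_mono)
  also have "\<dots> = b / (real n)\<^sup>2 * (real n * signal_energy n S w)"
    unfolding sum_distrib_left[symmetric] trig_parseval[OF n] signal_energy_def ..
  also have "\<dots> = b / real n * signal_energy n S w"
    using pos by (simp add: power2_eq_square)
  finally show "expectation (\<lambda>\<omega>. (signal_noise n S s (\<lambda>l. \<xi> l \<omega>) w)\<^sup>2) \<le> b / real n * signal_energy n S w" .
qed

text \<open>Of the two squared volatilities in each coefficient only one is bounded by b. The other
  is kept, so that the sum over l rebuilds \<open>vol n s\<close> and with it the penalty. The 4 is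
  the 2 of the off-diagonal form times the 2 of \<open>sum_sq_kern\<close>.\<close>

lemma second_moment_off_diag:
  assumes n: "odd n" and s: "\<And>l. l \<in> {1..n} \<Longrightarrow> (s l)\<^sup>2 \<le> b"
  shows "integrable M (\<lambda>\<omega>. (off_diag n s (\<lambda>l. \<xi> l \<omega>) w)\<^sup>2)"
    and "expectation (\<lambda>\<omega>. (off_diag n s (\<lambda>l. \<xi> l \<omega>) w)\<^sup>2) \<le> 4 * b / real n * penalty n (vol n s) w"
proof -
  have pos: "n > 0" using n by (cases n) auto
  let ?a = "\<lambda>l r. s l * s r * kern n w l r"
  let ?Q = "\<lambda>\<omega>. \<Sum>l=1..n. \<Sum>r\<in>{1..n} - {l}. ?a l r * \<xi> l \<omega> * \<xi> r \<omega>"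
  have sym: "?a l r = ?a r l" for l r
    by (simp add: kern_def ac_simps)
  have Q: "integrable M (\<lambda>\<omega>. (?Q \<omega>)\<^sup>2)"
      "expectation (\<lambda>\<omega>. (?Q \<omega>)\<^sup>2) = 2 * (\<Sum>l=1..n. \<Sum>r\<in>{1..n} - {l}. (?a l r)\<^sup>2)"
    using second_moment_off_diagonal_form[OF noise_indep _ subset_refl, of ?a] noise_moments sym
    by simp_all
  have off: "(off_diag n s (\<lambda>l. \<xi> l \<omega>) w)\<^sup>2 = (1 / (real n)\<^sup>2)\<^sup>2 * (?Q \<omega>)\<^sup>2" for \<omega>
    unfolding off_diag_def by (rule power_mult_distrib)
  show "integrable M (\<lambda>\<omega>. (off_diag n s (\<lambda>l. \<xi> l \<omega>) w)\<^sup>2)"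
    unfolding off by (intro integrable_mult_right Q)
  have b: "0 \<le> b" using s[of 1] pos by (auto intro: order_trans[OF zero_le_power2])
  have "(\<Sum>r\<in>{1..n} - {l}. (?a l r)\<^sup>2) \<le> (s l)\<^sup>2 * (b * (2 * real n * weight_norm_sq n w))"
    if "l \<in> {1..n}" for l
  proof -
    have "(\<Sum>r\<in>{1..n} - {l}. (?a l r)\<^sup>2) \<le> (\<Sum>r=1..n. (?a l r)\<^sup>2)"
      by (intro sum_mono2) auto
    also have "\<dots> \<le> (\<Sum>r=1..n. (s l)\<^sup>2 * (b * (kern n w l r)\<^sup>2))"
      using s by (intro sum_mono) (auto simp: power_mult_distrib mult.assoc intro!: mult_left_mono mult_right_mono)
    also have "\<dots> = (s l)\<^sup>2 * (b * (\<Sum>r=1..n. (kern n w l r)\<^sup>2))"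
      by (simp add: sum_distrib_left)
    also have "\<dots> \<le> (s l)\<^sup>2 * (b * (2 * real n * weight_norm_sq n w))"
      by (intro mult_left_mono sum_sq_kern n b) auto
    finally show ?thesis .
  qed
  then have "(\<Sum>l=1..n. \<Sum>r\<in>{1..n} - {l}. (?a l r)\<^sup>2)
      \<le> (\<Sum>l=1..n. (s l)\<^sup>2 * (b * (2 * real n * weight_norm_sq n w)))"
    by (rule sum_mono)
  also have "\<dots> = 2 * b * (real n)^2 * vol n s * weight_norm_sq n w"
    using pos unfolding sum_distrib_right[symmetric] by (simp add: vol_def power2_eq_square)
  finally have "(1 / (real n)\<^sup>2)\<^sup>2 * (2 * (\<Sum>l=1..n. \<Sum>r\<in>{1..n} - {l}. (?a l r)\<^sup>2))
      \<le> (1 / (real n)\<^sup>2)\<^sup>2 * (2 * (2 * b * (real n)^2 * vol n s * weight_norm_sq n w))"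
    by (intro mult_left_mono) auto
  also have "\<dots> = 4 * b / real n * penalty n (vol n s) w"
    using pos by (simp add: penalty_def power2_eq_square field_simps)
  finally show "expectation (\<lambda>\<omega>. (off_diag n s (\<lambda>l. \<xi> l \<omega>) w)\<^sup>2) \<le> 4 * b / real n * penalty n (vol n s) w"
    unfolding off integral_mult_right_zero Q(2) .
qed

text \<open>A linear form in the independent centred variables \<xi>^2 - 1, whose variance is
  \<open>\<xi>star - 1\<close>. With n coefficients of size at most b K / n^2, its standard
  deviation gains 1/sqrt n over the trivial bound.\<close>

lemma mean_abs_diag_fluct:
  assumes n: "odd n" and s: "\<And>l. l \<in> {1..n} \<Longrightarrow> (s l)\<^sup>2 \<le> b"
    and k: "\<And>l. l \<in> {1..n} \<Longrightarrow> \<bar>kern n w l l\<bar> \<le> K"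
  shows "integrable M (\<lambda>\<omega>. diag_fluct n s (\<lambda>l. \<xi> l \<omega>) w)"
    and "expectation (\<lambda>\<omega>. \<bar>diag_fluct n s (\<lambda>l. \<xi> l \<omega>) w\<bar>) \<le> b / real n * K * (sqrt (\<xi>star - 1) / sqrt (real n))"
proof -
  have pos: "n > 0" using n by (cases n) auto
  have b: "0 \<le> b" using s[of 1] pos by (auto intro: order_trans[OF zero_le_power2])
  have K: "0 \<le> K" using k[of 1] pos by auto
  let ?c = "\<lambda>l. (1 / (real n)\<^sup>2) * ((s l)\<^sup>2 * kern n w l l)"
  have eq: "diag_fluct n s z w = (\<Sum>l=1..n. ?c l * ((z l)\<^sup>2 - 1))" for z
    unfolding diag_fluct_def sum_distrib_left by (simp only: mult.assoc)
  have ind: "indep_vars (\<lambda>_. borel) (\<lambda>l \<omega>. (\<xi> l \<omega>)\<^sup>2 - 1) {1..n}"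
    by (rule indep_vars_compose2[OF noise_indep]) auto
  have sq: "integrable M (\<lambda>\<omega>. (diag_fluct n s (\<lambda>l. \<xi> l \<omega>) w)\<^sup>2)"
    "expectation (\<lambda>\<omega>. (diag_fluct n s (\<lambda>l. \<xi> l \<omega>) w)\<^sup>2) = (\<xi>star - 1) * (\<Sum>l=1..n. (?c l)\<^sup>2)"
    using second_moment_linear_form[OF ind _ subset_refl, of "\<xi>star - 1" ?c] noise_moments
    unfolding eq by simp_all
  have [measurable]: "(\<lambda>\<omega>. diag_fluct n s (\<lambda>l. \<xi> l \<omega>) w) \<in> borel_measurable M"
    using noise_measurable unfolding diag_fluct_def by (auto intro!: borel_measurable_sum borel_measurable_times)
  note abs = square_integrable_imp_abs[OF this sq(1)]
  show "integrable M (\<lambda>\<omega>. diag_fluct n s (\<lambda>l. \<xi> l \<omega>) w)" by (rule abs)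
  have x: "0 \<le> \<xi>star - 1"
    using fourth_moment_ge_1[OF pos] by simp
  have "(?c l)\<^sup>2 \<le> ((1 / (real n)\<^sup>2) * (b * K))\<^sup>2" if "l \<in> {1..n}" for l
  proof (rule power2_le_iff_abs_le[THEN iffD2])
    show "\<bar>?c l\<bar> \<le> (1 / (real n)\<^sup>2) * (b * K)"
      using s[OF that] k[OF that] b unfolding abs_mult
      by (intro mult_mono) (auto)
  qed (use b K in simp)
  then have "(\<Sum>l=1..n. (?c l)\<^sup>2) \<le> (\<Sum>l=1..n. ((1 / (real n)\<^sup>2) * (b * K))\<^sup>2)"
    by (rule sum_mono)
  also have "\<dots> = (b / real n * K / sqrt (real n))\<^sup>2"
    using pos by (simp add: power_mult_distrib power_divide) (simp add: power2_eq_square power4_eq_xxxx)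
  finally have "(\<xi>star - 1) * (\<Sum>l=1..n. (?c l)\<^sup>2) \<le> (\<xi>star - 1) * (b / real n * K / sqrt (real n))\<^sup>2"
    using x by (rule mult_left_mono)
  then have "sqrt ((\<xi>star - 1) * (\<Sum>l=1..n. (?c l)\<^sup>2)) \<le> sqrt ((\<xi>star - 1) * (b / real n * K / sqrt (real n))\<^sup>2)"
    by (rule real_sqrt_le_mono)
  also have "\<dots> = b / real n * K * (sqrt (\<xi>star - 1) / sqrt (real n))"
    using b K by (simp add: real_sqrt_mult)
  finally show "expectation (\<lambda>\<omega>. \<bar>diag_fluct n s (\<lambda>l. \<xi> l \<omega>) w\<bar>)
      \<le> b / real n * K * (sqrt (\<xi>star - 1) / sqrt (real n))"
    using abs(2) unfolding sq(2) by linarith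
qed

lemma mean_remainder:
  assumes n: "odd n" and \<rho>: "0 < \<rho>" "\<rho> < 1"
    and s: "\<And>l. l \<in> {1..n} \<Longrightarrow> (s l)\<^sup>2 \<le> b" and sv: "0 < vol n s"
    and range: "\<And>j. j \<in> {1..n} \<Longrightarrow> lam j \<in> {0..1}" "\<And>j. j \<in> {1..n} \<Longrightarrow> lam0 j \<in> {0..1}"
    and k: "\<And>l. l \<in> {1..n} \<Longrightarrow> \<bar>kern n lam l l\<bar> \<le> K"
  shows "integrable M (\<lambda>\<omega>. remainder n S \<rho> lam0 s (\<lambda>l. \<xi> l \<omega>) lam)"
    and "expectation (\<lambda>\<omega>. remainder n S \<rho> lam0 s (\<lambda>l. \<xi> l \<omega>) lam)
      \<le> (1 - \<rho>) * (8 * b / (\<rho> * real n) + 4 * (b / real n * K * (sqrt (\<xi>star - 1) / sqrt (real n)))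
          + b / (\<rho> * real n)) + b / real n"
proof -
  have pos: "n > 0" using n by (cases n) auto
  have b: "0 \<le> b" using s[of 1] pos by (auto intro: order_trans[OF zero_le_power2])
  let ?x = "\<lambda>j. lam j - lam0 j"
  let ?P = "penalty n (vol n s) lam" let ?T = "signal_energy n S ?x"
  have P: "0 \<le> ?P" using sv by (simp add: penalty_def weight_norm_sq_def sum_nonneg)
  \<comment> \<open>Also covers t = 0, where the quotient is 0 by convention.\<close>
  have div: "e / t \<le> c" if "e \<le> c * t" "0 \<le> t" "0 \<le> c" for e t c :: real
    using that by (cases "t = 0") (auto simp: divide_le_eq)
  note off = second_moment_off_diag[where s = s and w = lam, OF n s]
  note dia = mean_abs_diag_fluct[where s = s and w = lam, OF n s k]
  note sn1 = second_moment_signal_noise[where s = s and w = ?x, OF n s]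
  note sn2 = second_moment_signal_noise[where s = s and w = "\<lambda>j. (?x j)\<^sup>2", OF n s]
  show "integrable M (\<lambda>\<omega>. remainder n S \<rho> lam0 s (\<lambda>l. \<xi> l \<omega>) lam)"
    unfolding remainder_def
    by (intro Bochner_Integration.integrable_add integrable_mult_right integrable_divide
        Bochner_Integration.integrable_abs off(1) dia(1) sn1(1) sn2(1))
  \<comment> \<open>Differences of weights in [0, 1] have modulus at most 1, so squaring them does
    not increase the energy; both signal quotients can thus use the same denominator T.\<close>
  have "signal_energy n S (\<lambda>j. (?x j)\<^sup>2) \<le> ?T"
    unfolding signal_energy_def
  proof (rule sum_mono)
    fix j assume j: "j \<in> {1..n}"
    have "\<bar>?x j\<bar> \<le> 1" using range(1)[OF j] range(2)[OF j] by auto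
    then have "((?x j)\<^sup>2)\<^sup>2 \<le> (?x j)\<^sup>2"
      unfolding power2_eq_square[of "(?x j)\<^sup>2"] by (intro mult_left_le) (simp_all add: abs_square_le_1)
    then show "((?x j)\<^sup>2 * fourier_coef n S j)\<^sup>2 \<le> (?x j * fourier_coef n S j)\<^sup>2"
      unfolding power_mult_distrib by (rule mult_right_mono) simp
  qed
  then have "expectation (\<lambda>\<omega>. (signal_noise n S s (\<lambda>l. \<xi> l \<omega>) (\<lambda>j. (?x j)\<^sup>2))\<^sup>2) \<le> b / real n * ?T"
    using sn2(2) b by (meson divide_nonneg_nonneg mult_left_mono of_nat_0_le_iff order_trans)
  then have e2: "expectation (\<lambda>\<omega>. (signal_noise n S s (\<lambda>l. \<xi> l \<omega>) (\<lambda>j. (?x j)\<^sup>2))\<^sup>2) / ?T \<le> b / real n"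
    using b by (intro div) (auto simp: signal_energy_nonneg)
  have e1: "expectation (\<lambda>\<omega>. (signal_noise n S s (\<lambda>l. \<xi> l \<omega>) ?x)\<^sup>2) / (\<rho> * ?T) \<le> b / (\<rho> * real n)"
    using b sn1(2) \<rho> by (intro div) (auto simp: signal_energy_nonneg)
  have e3: "expectation (\<lambda>\<omega>. (off_diag n s (\<lambda>l. \<xi> l \<omega>) lam)\<^sup>2) / (\<rho> * ?P) \<le> 4 * b / (\<rho> * real n)"
    using b off(2) \<rho> P by (intro div) auto
  have "expectation (\<lambda>\<omega>. remainder n S \<rho> lam0 s (\<lambda>l. \<xi> l \<omega>) lam)
    = (1 - \<rho>) * (2 * (expectation (\<lambda>\<omega>. (off_diag n s (\<lambda>l. \<xi> l \<omega>) lam)\<^sup>2) / (\<rho> * ?P))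
        + 4 * expectation (\<lambda>\<omega>. \<bar>diag_fluct n s (\<lambda>l. \<xi> l \<omega>) lam\<bar>)
        + expectation (\<lambda>\<omega>. (signal_noise n S s (\<lambda>l. \<xi> l \<omega>) ?x)\<^sup>2) / (\<rho> * ?T))
      + expectation (\<lambda>\<omega>. (signal_noise n S s (\<lambda>l. \<xi> l \<omega>) (\<lambda>j. (?x j)\<^sup>2))\<^sup>2) / ?T"
    unfolding remainder_def using off(1) dia(1) sn1(1) sn2(1) by simp
  also have "\<dots> \<le> (1 - \<rho>) * (8 * b / (\<rho> * real n) + 4 * (b / real n * K * (sqrt (\<xi>star - 1) / sqrt (real n)))
          + b / (\<rho> * real n)) + b / real n"
    using \<rho> e1 e2 e3 dia(2) by (intro add_mono mult_left_mono) auto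
  finally show "expectation (\<lambda>\<omega>. remainder n S \<rho> lam0 s (\<lambda>l. \<xi> l \<omega>) lam)
      \<le> (1 - \<rho>) * (8 * b / (\<rho> * real n) + 4 * (b / real n * K * (sqrt (\<xi>star - 1) / sqrt (real n)))
          + b / (\<rho> * real n)) + b / real n" .
qed

text \<open>The coefficient loss splits into a squared bias, which is dropped, a cross term of mean
  zero, and the noise energy weighted by squared weights. The mean of the last is the penalty plus
  the volatility bias of those squares.\<close>

lemma mean_loss_ge_penalty:
  assumes n: "odd n" and s: "\<And>l. l \<in> {1..n} \<Longrightarrow> (s l)\<^sup>2 \<le> b"
    and k: "\<And>x. x \<in> {0..1} \<Longrightarrow> \<bar>\<Sum>j=1..n. (lam j)\<^sup>2 * trig_bar j x\<bar> \<le> K"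
  shows "integrable M (\<lambda>\<omega>. loss n S (model_obs n S s (\<lambda>l. \<xi> l \<omega>)) lam)"
    and "penalty n (vol n s) lam
      \<le> expectation (\<lambda>\<omega>. loss n S (model_obs n S s (\<lambda>l. \<xi> l \<omega>)) lam) + K * b / real n"
proof -
  have pos: "n > 0" using n by (cases n) auto
  let ?e = "\<lambda>\<omega>. noise_coef n s (\<lambda>l. \<xi> l \<omega>)"
  have e: "integrable M (\<lambda>\<omega>. ?e \<omega> j)" "integrable M (\<lambda>\<omega>. (?e \<omega> j)\<^sup>2)"
    "expectation (\<lambda>\<omega>. ?e \<omega> j) = 0"
    "expectation (\<lambda>\<omega>. (?e \<omega> j)\<^sup>2) = (\<Sum>l=1..n. (s l * trig j (design n l) / real n)\<^sup>2)" for j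
    unfolding noise_coef_linear by (rule noise_linear_form)+
  have loss: "loss n S (model_obs n S s z) lam
      = (\<Sum>j=1..n. (lam j)\<^sup>2 * ((fourier_coef n S j)\<^sup>2 + 2 * fourier_coef n S j * noise_coef n s z j + (noise_coef n s z j)\<^sup>2))
      - 2 * (\<Sum>j=1..n. lam j * fourier_coef n S j * (fourier_coef n S j + noise_coef n s z j)) + emp_norm_sq n S" for z
    unfolding loss_expand[OF n] theta_hat_model_obs by (simp add: power2_sum ac_simps)
  show int: "integrable M (\<lambda>\<omega>. loss n S (model_obs n S s (\<lambda>l. \<xi> l \<omega>)) lam)"
    unfolding loss using e(1,2) by (intro Bochner_Integration.integrable_add Bochner_Integration.integrable_diff
        Bochner_Integration.integrable_sum integrable_mult_right) auto
  have lower: "2 * (\<Sum>j=1..n. lam j * (lam j - 1) * fourier_coef n S j * noise_coef n s z j)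
      + (\<Sum>j=1..n. (lam j)\<^sup>2 * (noise_coef n s z j)\<^sup>2) \<le> loss n S (model_obs n S s z) lam" for z
  proof -
    have "2 * (\<Sum>j=1..n. lam j * (lam j - 1) * fourier_coef n S j * noise_coef n s z j)
      + (\<Sum>j=1..n. (lam j)\<^sup>2 * (noise_coef n s z j)\<^sup>2)
      \<le> (\<Sum>j=1..n. (lam j * theta_hat n (model_obs n S s z) j - fourier_coef n S j)\<^sup>2)"
      unfolding sum_distrib_left sum.distrib[symmetric]
    proof (rule sum_mono)
      fix j
      let ?t = "fourier_coef n S j" and ?z = "noise_coef n s z j"
      have "(lam j * theta_hat n (model_obs n S s z) j - ?t)\<^sup>2
        = ((lam j - 1) * ?t)\<^sup>2 + (2 * (lam j * (lam j - 1) * ?t * ?z) + (lam j)\<^sup>2 * ?z\<^sup>2)"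
        unfolding theta_hat_model_obs by (simp add: power2_eq_square algebra_simps)
      then show "2 * (lam j * (lam j - 1) * ?t * ?z) + (lam j)\<^sup>2 * ?z\<^sup>2
        \<le> (lam j * theta_hat n (model_obs n S s z) j - ?t)\<^sup>2" by simp
    qed
    then show ?thesis using loss_ge_coef_loss[OF n, of lam "model_obs n S s z" S] by linarith
  qed
  have "penalty n (vol n s) lam + vol_bias n s (\<lambda>j. (lam j)\<^sup>2)
      = (\<Sum>j=1..n. (lam j)\<^sup>2 * (\<Sum>l=1..n. (s l * trig j (design n l) / real n)\<^sup>2))"
  proof -
    have "(\<Sum>j=1..n. (lam j)\<^sup>2 * (\<Sum>l=1..n. (s l * trig j (design n l) / real n)\<^sup>2))
      = (\<Sum>l=1..n. \<Sum>j=1..n. 1 / (real n)\<^sup>2 * ((s l)\<^sup>2 * ((lam j)\<^sup>2 + (lam j)\<^sup>2 * trig_bar j (design n l))))"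
      unfolding sum_distrib_left
      by (subst sum.swap) (simp add: trig_bar_def power_mult_distrib power_divide algebra_simps)
    also have "\<dots> = 1 / (real n)\<^sup>2 * (\<Sum>l=1..n. (s l)\<^sup>2 * (\<Sum>j=1..n. (lam j)\<^sup>2))
        + vol_bias n s (\<lambda>j. (lam j)\<^sup>2)"
      by (simp add: vol_bias_def sum_distrib_left sum.distrib distrib_left)
    also have "1 / (real n)\<^sup>2 * (\<Sum>l=1..n. (s l)\<^sup>2 * (\<Sum>j=1..n. (lam j)\<^sup>2)) = penalty n (vol n s) lam"
      by (simp add: penalty_def vol_def weight_norm_sq_def sum_distrib_right[symmetric] power2_eq_square)
    finally show ?thesis by simp
  qed
  also have "\<dots> = expectation (\<lambda>\<omega>. 2 * (\<Sum>j=1..n. lam j * (lam j - 1) * fourier_coef n S j * ?e \<omega> j)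
      + (\<Sum>j=1..n. (lam j)\<^sup>2 * (?e \<omega> j)\<^sup>2))"
    using e by (simp add: Bochner_Integration.integral_sum)
  also have "\<dots> \<le> expectation (\<lambda>\<omega>. loss n S (model_obs n S s (\<lambda>l. \<xi> l \<omega>)) lam)"
    using e(1,2) int lower by (intro integral_mono) auto
  finally have "penalty n (vol n s) lam + vol_bias n s (\<lambda>j. (lam j)\<^sup>2)
      \<le> expectation (\<lambda>\<omega>. loss n S (model_obs n S s (\<lambda>l. \<xi> l \<omega>)) lam)" .
  moreover have "\<bar>vol_bias n s (\<lambda>j. (lam j)\<^sup>2)\<bar> \<le> K * b / real n"
    by (rule abs_vol_bias_le[OF pos s k])
  ultimately show "penalty n (vol n s) lam
      \<le> expectation (\<lambda>\<omega>. loss n S (model_obs n S s (\<lambda>l. \<xi> l \<omega>)) lam) + K * b / real n"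
    by linarith
qed

end

section \<open>Integration over the volatilities\<close>

lemma abs_kern_diag_le:
  assumes \<Lambda>: "\<Lambda> \<subseteq> {1..n} \<rightarrow>\<^sub>E {0..1}" "finite \<Lambda>" and lam: "lam \<in> \<Lambda>" and l: "l \<in> {1..n}"
  shows "\<bar>kern n lam l l\<bar> \<le> weight_sum_max n \<Lambda> + weight_trig_max 1 n \<Lambda>"
proof -
  have "design n l \<in> {0..1}" using l by (simp add: design_def)
  from weight_trig_le_max[OF \<Lambda>(2) lam this, where i = 1 and n = n]
  have "\<bar>\<Sum>j=1..n. lam j * trig_bar j (design n l)\<bar> \<le> weight_trig_max 1 n \<Lambda>"
    by (simp only: power_one_right)
  moreover have "0 \<le> (\<Sum>j=1..n. lam j)"
    using \<Lambda>(1) lam by (intro sum_nonneg) fastforce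
  moreover note weight_sum_le_max[OF \<Lambda>(2) lam, of n]
  ultimately show ?thesis
    unfolding kern_diag by linarith
qed

text \<open>The bound of \<open>mean_remainder\<close>, once for each weight, plus the volatility
  bias paid when the penalty of \<open>lam0\<close> is replaced by its mean loss.\<close>

definition remainder_bound :: "nat \<Rightarrow> (nat \<Rightarrow> real) set \<Rightarrow> real \<Rightarrow> real \<Rightarrow> real \<Rightarrow> real" where
  "remainder_bound n \<Lambda> \<xi>star b \<rho> = real (card \<Lambda>) *
     ((1 - \<rho>) * (8 * b / (\<rho> * real n)
        + 4 * (b / real n * (weight_sum_max n \<Lambda> + weight_trig_max 1 n \<Lambda>) * (sqrt (\<xi>star - 1) / sqrt (real n)))
        + b / (\<rho> * real n)) + b / real n)
     + 2 * \<rho> * (1 - \<rho>) * (weight_trig_max 2 n \<Lambda> * b / real n)"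

lemma weight_max_nonneg:
  assumes \<Lambda>: "\<Lambda> \<subseteq> {1..n} \<rightarrow>\<^sub>E {0..1}" "finite \<Lambda>" and lam: "lam \<in> \<Lambda>"
  shows "0 \<le> weight_sum_max n \<Lambda>" "0 \<le> weight_trig_max i n \<Lambda>"
proof -
  have "0 \<le> (\<Sum>j=1..n. lam j)"
    using \<Lambda>(1) lam by (intro sum_nonneg) fastforce
  then show "0 \<le> weight_sum_max n \<Lambda>"
    using weight_sum_le_max[OF \<Lambda>(2) lam, of n] by linarith
  show "0 \<le> weight_trig_max i n \<Lambda>"
    using weight_trig_le_max[OF \<Lambda>(2) lam, where x = 0 and i = i and n = n] by force
qed

lemma remainder_bound_nonneg:
  assumes "\<Lambda> \<subseteq> {1..n} \<rightarrow>\<^sub>E {0..1}" "finite \<Lambda>" "lam \<in> \<Lambda>" "0 < \<rho>" "\<rho> < 1" "0 \<le> b" "1 \<le> \<xi>star"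
  shows "0 \<le> remainder_bound n \<Lambda> \<xi>star b \<rho>"
  using assms weight_max_nonneg[OF assms(1-3)] unfolding remainder_bound_def
  by (intro add_nonneg_nonneg mult_nonneg_nonneg divide_nonneg_nonneg) auto

lemma remainder_nonneg:
  "0 < \<rho> \<Longrightarrow> \<rho> < 1 \<Longrightarrow> 0 \<le> vol n s \<Longrightarrow> 0 \<le> remainder n S \<rho> lam0 s z lam"
  unfolding remainder_def
  by (intro add_nonneg_nonneg mult_nonneg_nonneg divide_nonneg_nonneg)
     (auto simp: signal_energy_nonneg penalty_def weight_norm_sq_def sum_nonneg)

lemma vol_nonneg: "0 \<le> vol n s"
  by (simp add: vol_def sum_nonneg)

lemma penalty_vol_nonneg: "0 \<le> penalty n (vol n s) lam"
  by (simp add: penalty_def weight_norm_sq_def sum_nonneg vol_nonneg)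

text \<open>Needed over two spaces: the product space of volatility and noise vectors, and
  \<open>M\<close> itself.\<close>

lemma measurable_remainder:
  assumes s: "\<And>l. l \<in> {1..n} \<Longrightarrow> (\<lambda>p. s p l) \<in> borel_measurable N"
    and z: "\<And>l. l \<in> {1..n} \<Longrightarrow> (\<lambda>p. z p l) \<in> borel_measurable N"
  shows "(\<lambda>p. remainder n S \<rho> lam0 (s p) (z p) lam) \<in> borel_measurable N"
    and "(\<lambda>p. loss n S (model_obs n S (s p) (z p)) lam) \<in> borel_measurable N"
    and "(\<lambda>p. penalty n (vol n (s p)) lam) \<in> borel_measurable N"
proof -
  have [measurable]: "(\<lambda>p. off_diag n (s p) (z p) lam) \<in> borel_measurable N"
    using s z unfolding off_diag_def by (auto intro!: borel_measurable_sum borel_measurable_times)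
  have [measurable]: "(\<lambda>p. diag_fluct n (s p) (z p) lam) \<in> borel_measurable N"
    using s z unfolding diag_fluct_def
    by (auto intro!: borel_measurable_sum borel_measurable_times borel_measurable_power borel_measurable_diff)
  have [measurable]: "(\<lambda>p. noise_coef n (s p) (z p) j) \<in> borel_measurable N" for j
    using s z unfolding noise_coef_linear
    by (auto intro!: borel_measurable_sum borel_measurable_times borel_measurable_divide)
  have [measurable]: "(\<lambda>p. vol n (s p)) \<in> borel_measurable N"
    using s unfolding vol_def by (auto intro!: borel_measurable_sum borel_measurable_times borel_measurable_power)
  show "(\<lambda>p. penalty n (vol n (s p)) lam) \<in> borel_measurable N"
    unfolding penalty_def by measurable
  show "(\<lambda>p. remainder n S \<rho> lam0 (s p) (z p) lam) \<in> borel_measurable N"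
    unfolding remainder_def signal_noise_def penalty_def by measurable
  show "(\<lambda>p. loss n S (model_obs n S (s p) (z p)) lam) \<in> borel_measurable N"
    unfolding loss_def weighted_est_def theta_hat_model_obs emp_norm_sq_def emp_inner_def by measurable
qed

context heteroscedastic_regression
begin

text \<open>The mean loss on the right is left as an integral over the noise, so that the outer
  integration over the volatilities turns it into the risk of \<open>lam0\<close>.\<close>

lemma conditional_remainder_bound:
  assumes n: "odd n" and \<rho>: "0 < \<rho>" "\<rho> < 1"
    and \<Lambda>: "\<Lambda> \<subseteq> {1..n} \<rightarrow>\<^sub>E {0..1}" "finite \<Lambda>" and lam0: "lam0 \<in> \<Lambda>"
    and s: "\<And>l. l \<in> {1..n} \<Longrightarrow> 0 < s l" "\<And>l. l \<in> {1..n} \<Longrightarrow> (s l)\<^sup>2 \<le> b"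
  shows "(\<integral>\<^sup>+\<omega>. ennreal (2 * \<rho> * (1 - \<rho>) * penalty n (vol n s) lam0
            + (\<Sum>lam\<in>\<Lambda>. remainder n S \<rho> lam0 s (\<lambda>l. \<xi> l \<omega>) lam)) \<partial>M)
      \<le> (\<integral>\<^sup>+\<omega>. ennreal (2 * \<rho> * (1 - \<rho>) * loss n S (model_obs n S s (\<lambda>l. \<xi> l \<omega>)) lam0
            + remainder_bound n \<Lambda> \<xi>star b \<rho>) \<partial>M)"
proof -
  have pos: "n > 0" using n by (cases n) auto
  let ?K = "weight_sum_max n \<Lambda> + weight_trig_max 1 n \<Lambda>"
  have range: "w j \<in> {0..1}" if "w \<in> \<Lambda>" "j \<in> {1..n}" for w j
    using \<Lambda>(1) that by blast
  have vpos: "0 < vol n s"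
  proof -
    have "0 < (\<Sum>l=1..n. (s l)\<^sup>2)"
      using pos s(1) by (intro sum_pos zero_less_power) auto
    then show ?thesis using pos by (simp add: vol_def)
  qed
  have rem: "integrable M (\<lambda>\<omega>. remainder n S \<rho> lam0 s (\<lambda>l. \<xi> l \<omega>) w)"
    "expectation (\<lambda>\<omega>. remainder n S \<rho> lam0 s (\<lambda>l. \<xi> l \<omega>) w)
      \<le> (1 - \<rho>) * (8 * b / (\<rho> * real n) + 4 * (b / real n * ?K * (sqrt (\<xi>star - 1) / sqrt (real n)))
          + b / (\<rho> * real n)) + b / real n" if w: "w \<in> \<Lambda>" for w
    by (rule mean_remainder[OF n \<rho> _ vpos]; use s(2) range[OF w] range[OF lam0] abs_kern_diag_le[OF \<Lambda> w] in blast)+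
  note lo = mean_loss_ge_penalty[where s = s and lam = lam0 and K = "weight_trig_max 2 n \<Lambda>",
      OF n s(2) weight_trig_le_max[OF \<Lambda>(2) lam0]]
  have b: "0 \<le> b" using s(2)[of 1] pos by (auto intro: order_trans[OF zero_le_power2])
  have int1: "integrable M (\<lambda>\<omega>. 2 * \<rho> * (1 - \<rho>) * penalty n (vol n s) lam0
            + (\<Sum>lam\<in>\<Lambda>. remainder n S \<rho> lam0 s (\<lambda>l. \<xi> l \<omega>) lam))"
    using rem(1) by (intro Bochner_Integration.integrable_add Bochner_Integration.integrable_sum) auto
  have int2: "integrable M (\<lambda>\<omega>. 2 * \<rho> * (1 - \<rho>) * loss n S (model_obs n S s (\<lambda>l. \<xi> l \<omega>)) lam0
            + remainder_bound n \<Lambda> \<xi>star b \<rho>)"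
    using lo(1) by simp
  have "expectation (\<lambda>\<omega>. 2 * \<rho> * (1 - \<rho>) * penalty n (vol n s) lam0
            + (\<Sum>lam\<in>\<Lambda>. remainder n S \<rho> lam0 s (\<lambda>l. \<xi> l \<omega>) lam))
      = 2 * \<rho> * (1 - \<rho>) * penalty n (vol n s) lam0
        + (\<Sum>lam\<in>\<Lambda>. expectation (\<lambda>\<omega>. remainder n S \<rho> lam0 s (\<lambda>l. \<xi> l \<omega>) lam))"
    using rem(1) by (simp add: Bochner_Integration.integral_sum prob_space)
  also have "\<dots> \<le> 2 * \<rho> * (1 - \<rho>) * (expectation (\<lambda>\<omega>. loss n S (model_obs n S s (\<lambda>l. \<xi> l \<omega>)) lam0)
        + weight_trig_max 2 n \<Lambda> * b / real n)
     + (\<Sum>lam\<in>\<Lambda>. (1 - \<rho>) * (8 * b / (\<rho> * real n)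
          + 4 * (b / real n * ?K * (sqrt (\<xi>star - 1) / sqrt (real n))) + b / (\<rho> * real n)) + b / real n)"
    using \<rho> by (intro add_mono mult_left_mono lo sum_mono rem(2)) auto
  also have "\<dots> = expectation (\<lambda>\<omega>. 2 * \<rho> * (1 - \<rho>) * loss n S (model_obs n S s (\<lambda>l. \<xi> l \<omega>)) lam0
            + remainder_bound n \<Lambda> \<xi>star b \<rho>)"
    using lo(1) by (simp add: remainder_bound_def prob_space distrib_left)
  finally have main: "expectation (\<lambda>\<omega>. 2 * \<rho> * (1 - \<rho>) * penalty n (vol n s) lam0
            + (\<Sum>lam\<in>\<Lambda>. remainder n S \<rho> lam0 s (\<lambda>l. \<xi> l \<omega>) lam))
      \<le> expectation (\<lambda>\<omega>. 2 * \<rho> * (1 - \<rho>) * loss n S (model_obs n S s (\<lambda>l. \<xi> l \<omega>)) lam0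
            + remainder_bound n \<Lambda> \<xi>star b \<rho>)" .
  have C: "0 \<le> remainder_bound n \<Lambda> \<xi>star b \<rho>"
    by (rule remainder_bound_nonneg[OF \<Lambda> lam0 \<rho> b fourth_moment_ge_1[OF pos]])
  have "(\<integral>\<^sup>+\<omega>. ennreal (2 * \<rho> * (1 - \<rho>) * penalty n (vol n s) lam0
            + (\<Sum>lam\<in>\<Lambda>. remainder n S \<rho> lam0 s (\<lambda>l. \<xi> l \<omega>) lam)) \<partial>M)
      = ennreal (expectation (\<lambda>\<omega>. 2 * \<rho> * (1 - \<rho>) * penalty n (vol n s) lam0
            + (\<Sum>lam\<in>\<Lambda>. remainder n S \<rho> lam0 s (\<lambda>l. \<xi> l \<omega>) lam)))"
    using \<rho> vpos by (intro nn_integral_eq_integral int1 AE_I2 add_nonneg_nonneg mult_nonneg_nonneg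
        penalty_vol_nonneg sum_nonneg remainder_nonneg) auto
  also have "\<dots> \<le> ennreal (expectation (\<lambda>\<omega>. 2 * \<rho> * (1 - \<rho>) * loss n S (model_obs n S s (\<lambda>l. \<xi> l \<omega>)) lam0
            + remainder_bound n \<Lambda> \<xi>star b \<rho>))"
    by (rule ennreal_leI[OF main])
  also have "\<dots> = (\<integral>\<^sup>+\<omega>. ennreal (2 * \<rho> * (1 - \<rho>) * loss n S (model_obs n S s (\<lambda>l. \<xi> l \<omega>)) lam0
            + remainder_bound n \<Lambda> \<xi>star b \<rho>) \<partial>M)"
    using \<rho> C by (intro nn_integral_eq_integral[symmetric] int2 AE_I2 add_nonneg_nonneg mult_nonneg_nonneg loss_nonneg) auto
  finally show ?thesis .
qed

text \<open>The two integrands cannot be compared at a single outcome, only after averaging over the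
  noise. So volatility and noise are evaluated at separate outcomes, the inner integrals are
  compared for almost every volatility vector, and the outcomes are merged again.\<close>

lemma remainder_bound_expectation:
  assumes n: "odd n" and \<rho>: "0 < \<rho>" "\<rho> < 1"
    and \<Lambda>: "\<Lambda> \<subseteq> {1..n} \<rightarrow>\<^sub>E {0..1}" "finite \<Lambda>" and lam0: "lam0 \<in> \<Lambda>"
  shows "(\<integral>\<^sup>+\<omega>. ennreal (2 * \<rho> * (1 - \<rho>) * penalty n (vol n (\<lambda>l. \<sigma> S l \<omega>)) lam0
            + (\<Sum>lam\<in>\<Lambda>. remainder n S \<rho> lam0 (\<lambda>l. \<sigma> S l \<omega>) (\<lambda>l. \<xi> l \<omega>) lam)) \<partial>M)
      \<le> (\<integral>\<^sup>+\<omega>. ennreal (2 * \<rho> * (1 - \<rho>) * loss n S (model_obs n S (\<lambda>l. \<sigma> S l \<omega>) (\<lambda>l. \<xi> l \<omega>)) lam0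
            + remainder_bound n \<Lambda> \<xi>star \<sigma>star \<rho>) \<partial>M)"
proof -
  let ?B = "\<Pi>\<^sub>M l\<in>{1..n}. (borel :: real measure)"
  define X Y where "X = (\<lambda>\<omega>. \<lambda>l\<in>{1..n}. \<sigma> S l \<omega>)" and "Y = (\<lambda>\<omega>. \<lambda>l\<in>{1..n}. \<xi> l \<omega>)"
  define F1 where "F1 = (\<lambda>p. ennreal (2 * \<rho> * (1 - \<rho>) * penalty n (vol n (fst p)) lam0
            + (\<Sum>lam\<in>\<Lambda>. remainder n S \<rho> lam0 (fst p) (snd p) lam)))"
  define F2 where "F2 = (\<lambda>p. ennreal (2 * \<rho> * (1 - \<rho>) * loss n S (model_obs n S (fst p) (snd p)) lam0
            + remainder_bound n \<Lambda> \<xi>star \<sigma>star \<rho>))"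
  have comp: "(\<lambda>p. fst p l) \<in> borel_measurable (?B \<Otimes>\<^sub>M ?B)" "(\<lambda>p. snd p l) \<in> borel_measurable (?B \<Otimes>\<^sub>M ?B)"
    if "l \<in> {1..n}" for l
    using that by measurable
  note meas = measurable_remainder[where s = fst and z = snd, OF comp, simplified]
  have F: "F1 \<in> borel_measurable (?B \<Otimes>\<^sub>M ?B)" "F2 \<in> borel_measurable (?B \<Otimes>\<^sub>M ?B)"
    unfolding F1_def F2_def using meas by (auto intro!: measurable_compose[OF _ measurable_ennreal]
        borel_measurable_sum borel_measurable_add borel_measurable_times)
  have ind: "indep_var ?B X ?B Y"
    unfolding X_def Y_def by (rule vol_noise_indep)
  have F_cong: "F1 (s, z) = F1 (s', z')" "F2 (s, z) = F2 (s', z')"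
    if "\<And>l. l \<in> {1..n} \<Longrightarrow> s l = s' l" "\<And>l. l \<in> {1..n} \<Longrightarrow> z l = z' l" for s z s' z'
    by (simp_all only: F1_def F2_def fst_conv snd_conv remainder_cong[of n s s' z z', OF that])
  have cong: "F1 (X \<omega>, Y \<omega>') = F1 (\<lambda>l. \<sigma> S l \<omega>, \<lambda>l. \<xi> l \<omega>')"
    "F2 (X \<omega>, Y \<omega>') = F2 (\<lambda>l. \<sigma> S l \<omega>, \<lambda>l. \<xi> l \<omega>')" for \<omega> \<omega>'
    by (rule F_cong; simp add: X_def Y_def)+
  have "(\<integral>\<^sup>+\<omega>. F1 (\<lambda>l. \<sigma> S l \<omega>, \<lambda>l. \<xi> l \<omega>) \<partial>M) = (\<integral>\<^sup>+\<omega>. F1 (X \<omega>, Y \<omega>) \<partial>M)"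
    by (simp add: cong)
  also have "\<dots> = (\<integral>\<^sup>+\<omega>. \<integral>\<^sup>+\<omega>'. F1 (X \<omega>, Y \<omega>') \<partial>M \<partial>M)"
    by (rule indep_var_nn_integral_split[OF ind F(1)])
  also have "\<dots> \<le> (\<integral>\<^sup>+\<omega>. \<integral>\<^sup>+\<omega>'. F2 (X \<omega>, Y \<omega>') \<partial>M \<partial>M)"
  proof (rule nn_integral_mono_AE)
    show "AE \<omega> in M. (\<integral>\<^sup>+\<omega>'. F1 (X \<omega>, Y \<omega>') \<partial>M) \<le> (\<integral>\<^sup>+\<omega>'. F2 (X \<omega>, Y \<omega>') \<partial>M)"
      using vol_pos vol_bound
    proof eventually_elim
      case (elim \<omega>)
      then show ?case
        using conditional_remainder_bound[where s = "\<lambda>l. \<sigma> S l \<omega>", OF n \<rho> \<Lambda> lam0, of \<sigma>star]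
        unfolding cong unfolding F1_def F2_def by simp
    qed
  qed
  also have "\<dots> = (\<integral>\<^sup>+\<omega>. F2 (X \<omega>, Y \<omega>) \<partial>M)"
    by (rule indep_var_nn_integral_split[OF ind F(2), symmetric])
  also have "\<dots> = (\<integral>\<^sup>+\<omega>. F2 (\<lambda>l. \<sigma> S l \<omega>, \<lambda>l. \<xi> l \<omega>) \<partial>M)"
    by (simp add: cong)
  finally show ?thesis
    by (simp add: F1_def F2_def)
qed

end

text \<open>After multiplication by \<rho> n / b, for b > 0, the terms in the weight maxima agree
  exactly. The coefficient of the cardinality is 9 - 8\<rho>, with 8 from the off-diagonal form and
  1 from the linear one, and \<open>Psi\<close> offers 18 - 16\<rho>, twice as much.\<close>

lemma oracle_constants:
  assumes n: "n > 0" and \<rho>: "0 < \<rho>" "\<rho> < 1 / 3" and b: "0 \<le> b"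
  shows "(remainder_bound n \<Lambda> \<xi>star b \<rho> + (1 - \<rho>) * (4 * (weight_trig_max 1 n \<Lambda> * b / real n))) / (1 - 3 * \<rho>)
     \<le> 1 / real n * Psi n \<Lambda> \<xi>star b \<rho>"
proof -
  define \<nu> where "\<nu> = real (card \<Lambda>)"
  define x where "x = sqrt (\<xi>star - 1) / sqrt (real n)"
  define R where "R = weight_sum_max n \<Lambda>"
  define R1 where "R1 = weight_trig_max 1 n \<Lambda>"
  define R2 where "R2 = weight_trig_max 2 n \<Lambda>"
  have \<nu>: "0 \<le> \<nu>" by (simp add: \<nu>_def)
  have ups: "Upsilon_star n \<Lambda> \<xi>star \<rho> = 16 * \<nu> / \<rho> + 4 * R1 * (1 + \<nu> * x) + 4 * \<nu> * R * x"
    by (simp add: Upsilon_star_def Let_def \<nu>_def x_def R_def R1_def)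
  have "\<rho> * (remainder_bound n \<Lambda> \<xi>star b \<rho> + (1 - \<rho>) * (4 * (R1 * b / real n)))
     = (b / real n) * (\<nu> * ((1 - \<rho>) * 9 + \<rho>) + \<rho> * (1 - \<rho>) * (4 * \<nu> * (R + R1) * x) + 2 * \<rho>^2 * (1 - \<rho>) * R2
         + \<rho> * (1 - \<rho>) * (4 * R1))"
    unfolding remainder_bound_def \<nu>_def[symmetric] x_def[symmetric] R_def[symmetric] R1_def[symmetric] R2_def[symmetric]
    using n \<rho> by (simp add: field_simps power2_eq_square)
  also have "\<dots> \<le> (b / real n) * (\<rho> * (1 - \<rho>) * Upsilon_star n \<Lambda> \<xi>star \<rho> + 2 * \<nu> + 2 * \<rho>\<^sup>2 * (1 - \<rho>) * R2)"
  proof (rule mult_left_mono)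
    have "\<rho> * (1 - \<rho>) * Upsilon_star n \<Lambda> \<xi>star \<rho>
        = (1 - \<rho>) * (16 * \<nu>) + \<rho> * (1 - \<rho>) * (4 * \<nu> * (R + R1) * x) + \<rho> * (1 - \<rho>) * (4 * R1)"
      unfolding ups using \<rho> by (simp add: field_simps)
    moreover have "\<nu> * ((1 - \<rho>) * 9 + \<rho>) \<le> \<nu> * ((1 - \<rho>) * 16 + 2)"
      using \<rho> \<nu> by (intro mult_left_mono) auto
    moreover have "\<nu> * ((1 - \<rho>) * 16 + 2) = (1 - \<rho>) * (16 * \<nu>) + 2 * \<nu>"
      by (simp add: algebra_simps)
    ultimately show "\<nu> * ((1 - \<rho>) * 9 + \<rho>) + \<rho> * (1 - \<rho>) * (4 * \<nu> * (R + R1) * x) + 2 * \<rho>^2 * (1 - \<rho>) * R2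
         + \<rho> * (1 - \<rho>) * (4 * R1)
      \<le> \<rho> * (1 - \<rho>) * Upsilon_star n \<Lambda> \<xi>star \<rho> + 2 * \<nu> + 2 * \<rho>\<^sup>2 * (1 - \<rho>) * R2"
      by linarith
  qed (use b in simp)
  finally have "(\<rho> * (remainder_bound n \<Lambda> \<xi>star b \<rho> + (1 - \<rho>) * (4 * (R1 * b / real n)))) / (\<rho> * (1 - 3 * \<rho>))
    \<le> ((b / real n) * (\<rho> * (1 - \<rho>) * Upsilon_star n \<Lambda> \<xi>star \<rho> + 2 * \<nu> + 2 * \<rho>\<^sup>2 * (1 - \<rho>) * R2)) / (\<rho> * (1 - 3 * \<rho>))"
    using \<rho> by (intro divide_right_mono) auto
  then show ?thesis
    using \<rho> by (simp add: Psi_def \<nu>_def R1_def R2_def ac_simps)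
qed

section \<open>Translation to the notions of the statement, and assembly\<close>

lemma observation_eq_model_obs: "observation n S \<sigma> \<xi> \<omega> = model_obs n S (\<lambda>l. \<sigma> S l \<omega>) (\<lambda>l. \<xi> l \<omega>)"
  by (simp add: fun_eq_iff observation_def model_obs_def)

lemma mean_vol_eq_vol: "mean_vol n S \<sigma> \<omega> = vol n (\<lambda>l. \<sigma> S l \<omega>)"
  by (simp add: mean_vol_def vol_def)

lemma risk_eq: "risk M n S (observation n S \<sigma> \<xi>) L
   = (\<integral>\<^sup>+\<omega>. ennreal (loss n S (model_obs n S (\<lambda>l. \<sigma> S l \<omega>) (\<lambda>l. \<xi> l \<omega>)) (L \<omega>)) \<partial>M)"
  by (simp add: risk_def loss_def observation_eq_model_obs)

context heteroscedastic_regression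
begin

lemma oracle_inequality:
  assumes n: "odd n" and \<rho>: "0 < \<rho>" "\<rho> < 1 / 3"
    and \<Lambda>: "\<Lambda> \<subseteq> {1..n} \<rightarrow>\<^sub>E {0..1}" "finite \<Lambda>" and lam0: "lam0 \<in> \<Lambda>"
    and V: "V \<in> borel_measurable M"
    and lhat: "cost_minimizer M n \<rho> \<Lambda> (observation n S \<sigma> \<xi>) V lhat"
  shows "risk M n S (observation n S \<sigma> \<xi>) lhat
    \<le> ennreal (1 + kappa \<rho>) * risk M n S (observation n S \<sigma> \<xi>) (\<lambda>_. lam0)
      + ennreal (1 / real n) * B_term M n \<Lambda> \<xi>star \<sigma>star \<rho> V (mean_vol n S \<sigma>)"
proof -
  have pos: "n > 0" using n by (cases n) auto
  have b: "0 \<le> \<sigma>star" using bound_ge_1 by simp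
  define q where "q = 1 - 3 * \<rho>"
  have q: "0 < q" using \<rho> by (simp add: q_def)
  define y where "y = (\<lambda>\<omega>. model_obs n S (\<lambda>l. \<sigma> S l \<omega>) (\<lambda>l. \<xi> l \<omega>))"
  have risk_y: "risk M n S (observation n S \<sigma> \<xi>) L = (\<integral>\<^sup>+\<omega>. ennreal (loss n S (y \<omega>) (L \<omega>)) \<partial>M)" for L
    unfolding y_def by (rule risk_eq)
  define W where "W = mean_vol n S \<sigma>"
  define A where "A = (\<lambda>\<omega>. 2 * \<rho> * (1 - \<rho>) * penalty n (vol n (\<lambda>l. \<sigma> S l \<omega>)) lam0
            + (\<Sum>lam\<in>\<Lambda>. remainder n S \<rho> lam0 (\<lambda>l. \<sigma> S l \<omega>) (\<lambda>l. \<xi> l \<omega>) lam))"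
  define C where "C = remainder_bound n \<Lambda> \<xi>star \<sigma>star \<rho>"
  define c1 where "c1 = (1 - \<rho>) * (4 * (weight_trig_max 1 n \<Lambda> * \<sigma>star / real n))"
  define c2 where "c2 = 2 * (1 - \<rho>\<^sup>2) * weight_sum_max n \<Lambda> / real n"
  have C: "0 \<le> C"
    unfolding C_def using remainder_bound_nonneg[OF \<Lambda> lam0 \<rho>(1) _ b fourth_moment_ge_1[OF pos]] \<rho> by simp
  note meas = measurable_remainder[where s = "\<lambda>\<omega> l. \<sigma> S l \<omega>" and z = "\<lambda>\<omega> l. \<xi> l \<omega>" and N = M,
      OF vol_measurable noise_measurable]
  have [measurable]: "(\<lambda>\<omega>. loss n S (y \<omega>) lam0) \<in> borel_measurable M" "A \<in> borel_measurable M"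
    using meas unfolding y_def A_def by (auto intro!: borel_measurable_add borel_measurable_times borel_measurable_sum)
  have [measurable]: "W \<in> borel_measurable M" "V \<in> borel_measurable M"
    using vol_measurable V unfolding W_def mean_vol_def
    by (auto intro!: borel_measurable_times borel_measurable_sum borel_measurable_power)
  have A: "0 \<le> A \<omega>" for \<omega>
    using \<rho> unfolding A_def
    by (intro add_nonneg_nonneg mult_nonneg_nonneg penalty_vol_nonneg sum_nonneg remainder_nonneg vol_nonneg) auto
  have w1: "0 \<le> weight_trig_max 1 n \<Lambda>"
    by (rule weight_max_nonneg[OF \<Lambda> lam0])
  have c1: "0 \<le> c1"
    using \<rho> b w1 unfolding c1_def by (intro mult_nonneg_nonneg divide_nonneg_nonneg) auto
  have w: "0 \<le> weight_sum_max n \<Lambda>" by (rule weight_max_nonneg[OF \<Lambda> lam0])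
  have \<rho>2: "0 \<le> 1 - \<rho>\<^sup>2" using \<rho> by (simp add: power_le_one)
  have c2: "0 \<le> c2"
    using \<rho>2 w unfolding c2_def by (intro mult_nonneg_nonneg divide_nonneg_nonneg) auto
  \<comment> \<open>From here on \<open>lhat\<close> is gone from the right-hand side. Every summand
    there is nonnegative, so \<open>ennreal\<close> distributes over the sum and the terms can be
    integrated separately even if the error of \<open>V\<close> has infinite mean.\<close>
  have "AE \<omega> in M. ennreal (loss n S (y \<omega>) (lhat \<omega>)) \<le> ennreal (1 / q) * (ennreal (1 + \<rho>) * ennreal (loss n S (y \<omega>) lam0)
      + ennreal (A \<omega>) + ennreal c1 + ennreal c2 * ennreal \<bar>V \<omega> - W \<omega>\<bar>)"
    using vol_pos vol_bound AE_space
  proof eventually_elim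
    case (elim \<omega>)
    have mem: "lhat \<omega> \<in> \<Lambda>" and opt: "cost n \<rho> (y \<omega>) (V \<omega>) (lhat \<omega>) \<le> cost n \<rho> (y \<omega>) (V \<omega>) lam0"
      using lhat elim(3) lam0
      by (auto simp: cost_minimizer_def is_arg_min_linorder observation_eq_model_obs y_def)
    have "q * loss n S (y \<omega>) (lhat \<omega>)
        \<le> (1 + \<rho>) * loss n S (y \<omega>) lam0 + A \<omega> + c1 + c2 * \<bar>V \<omega> - W \<omega>\<bar>"
      using pathwise_oracle_inequality[OF n \<rho> \<Lambda> mem lam0 _ _ opt[unfolded y_def], of \<sigma>star] elim(1,2)
      by (simp add: q_def y_def A_def c1_def c2_def W_def mean_vol_eq_vol)
    then have "loss n S (y \<omega>) (lhat \<omega>)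
        \<le> 1 / q * ((1 + \<rho>) * loss n S (y \<omega>) lam0 + A \<omega> + c1 + c2 * \<bar>V \<omega> - W \<omega>\<bar>)"
      using q by (simp add: field_simps)
    then have "ennreal (loss n S (y \<omega>) (lhat \<omega>))
        \<le> ennreal (1 / q * ((1 + \<rho>) * loss n S (y \<omega>) lam0 + A \<omega> + c1 + c2 * \<bar>V \<omega> - W \<omega>\<bar>))"
      by (rule ennreal_leI)
    also have "\<dots> = ennreal (1 / q) * (ennreal (1 + \<rho>) * ennreal (loss n S (y \<omega>) lam0)
      + ennreal (A \<omega>) + ennreal c1 + ennreal c2 * ennreal \<bar>V \<omega> - W \<omega>\<bar>)"
    proof -
      have nonneg: "0 \<le> 1 / q" "0 \<le> 1 + \<rho>" using q \<rho> by simp_all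
      show ?thesis
        by (simp only: nonneg A c1 c2 loss_nonneg abs_ge_zero ennreal_mult ennreal_plus
            add_nonneg_nonneg mult_nonneg_nonneg)
    qed
    finally show ?case .
  qed
  then have "risk M n S (observation n S \<sigma> \<xi>) lhat
    \<le> (\<integral>\<^sup>+\<omega>. ennreal (1 / q) * (ennreal (1 + \<rho>) * ennreal (loss n S (y \<omega>) lam0)
      + ennreal (A \<omega>) + ennreal c1 + ennreal c2 * ennreal \<bar>V \<omega> - W \<omega>\<bar>) \<partial>M)"
    unfolding risk_y by (rule nn_integral_mono_AE)
  also have "\<dots> = ennreal (1 / q) * (ennreal (1 + \<rho>) * risk M n S (observation n S \<sigma> \<xi>) (\<lambda>_. lam0)
      + (\<integral>\<^sup>+\<omega>. ennreal (A \<omega>) \<partial>M) + ennreal c1 + ennreal c2 * mean_abs_error M V W)"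
    unfolding risk_y mean_abs_error_def
    by (simp add: nn_integral_cmult nn_integral_add emeasure_space_1)
  also have "\<dots> \<le> ennreal (1 / q) * (ennreal (1 + \<rho>) * risk M n S (observation n S \<sigma> \<xi>) (\<lambda>_. lam0)
      + (ennreal (2 * \<rho> * (1 - \<rho>)) * risk M n S (observation n S \<sigma> \<xi>) (\<lambda>_. lam0) + ennreal C)
      + ennreal c1 + ennreal c2 * mean_abs_error M V W)"
  proof -
    have "(\<integral>\<^sup>+\<omega>. ennreal (A \<omega>) \<partial>M) \<le> (\<integral>\<^sup>+\<omega>. ennreal (2 * \<rho> * (1 - \<rho>) * loss n S (y \<omega>) lam0 + C) \<partial>M)"
      using remainder_bound_expectation[OF n \<rho>(1) _ \<Lambda> lam0] \<rho> by (simp add: A_def y_def C_def)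
    also have "\<dots> = (\<integral>\<^sup>+\<omega>. ennreal (2 * \<rho> * (1 - \<rho>)) * ennreal (loss n S (y \<omega>) lam0) + ennreal C \<partial>M)"
      using \<rho> C by (intro nn_integral_cong) (simp add: ennreal_plus ennreal_mult'' loss_nonneg)
    also have "\<dots> = ennreal (2 * \<rho> * (1 - \<rho>)) * risk M n S (observation n S \<sigma> \<xi>) (\<lambda>_. lam0) + ennreal C"
      unfolding risk_y by (simp add: nn_integral_cmult nn_integral_add emeasure_space_1)
    finally show ?thesis by (intro mult_left_mono add_mono order_refl) auto
  qed
  also have "\<dots> = ennreal (1 + kappa \<rho>) * risk M n S (observation n S \<sigma> \<xi>) (\<lambda>_. lam0)
     + ennreal ((C + c1) / q) + ennreal (c2 / q) * mean_abs_error M V W"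
  proof -
    have "ennreal (1 / q) * (ennreal (1 + \<rho>) + ennreal (2 * \<rho> * (1 - \<rho>))) = ennreal (1 / q * ((1 + \<rho>) + 2 * \<rho> * (1 - \<rho>)))"
    proof -
      have nonneg: "0 \<le> 1 / q" "0 \<le> 1 + \<rho>" "0 \<le> 2 * \<rho> * (1 - \<rho>)" using q \<rho> by simp_all
      show ?thesis
        by (subst ennreal_mult[OF nonneg(1) add_nonneg_nonneg[OF nonneg(2,3)]], subst ennreal_plus[OF nonneg(2,3)]) (rule refl)
    qed
    also have "1 / q * ((1 + \<rho>) + 2 * \<rho> * (1 - \<rho>)) = 1 + kappa \<rho>"
      using q by (simp add: kappa_def q_def[symmetric]) (simp add: q_def field_simps power2_eq_square)
    finally have k: "ennreal (1 / q) * (ennreal (1 + \<rho>) + ennreal (2 * \<rho> * (1 - \<rho>))) = ennreal (1 + kappa \<rho>)" .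
    have k1: "ennreal ((C + c1) / q) = ennreal (1 / q) * (ennreal C + ennreal c1)"
      using C c1 q ennreal_mult[of "1 / q" "C + c1"] by simp
    have k2: "ennreal (c2 / q) = ennreal (1 / q) * ennreal c2"
      using c2 q ennreal_mult[of "1 / q" c2] by simp
    show ?thesis
      unfolding k[symmetric] k1 k2 by (simp only: distrib_left distrib_right ac_simps)
  qed
  also have "\<dots> \<le> ennreal (1 + kappa \<rho>) * risk M n S (observation n S \<sigma> \<xi>) (\<lambda>_. lam0)
      + ennreal (1 / real n) * B_term M n \<Lambda> \<xi>star \<sigma>star \<rho> V W"
  proof -
    have "ennreal ((C + c1) / q) \<le> ennreal (1 / real n * Psi n \<Lambda> \<xi>star \<sigma>star \<rho>)"
      unfolding C_def c1_def q_def by (intro ennreal_leI oracle_constants pos \<rho> b)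
    also have "\<dots> = ennreal (1 / real n) * ennreal (Psi n \<Lambda> \<xi>star \<sigma>star \<rho>)"
      by (rule ennreal_mult') simp
    finally have 1: "ennreal ((C + c1) / q) \<le> ennreal (1 / real n) * ennreal (Psi n \<Lambda> \<xi>star \<sigma>star \<rho>)" .
    have ks: "0 \<le> kappa_star \<rho>" using q \<rho>2 by (simp add: kappa_star_def q_def[symmetric])
    have "c2 / q \<le> 1 / real n * (kappa_star \<rho> * weight_sum_max n \<Lambda>)"
    proof -
      \<comment> \<open>The stated \<open>kappa_star\<close> is twice the coefficient that the
        pathwise inequality yields.\<close>
      have "1 / real n * (kappa_star \<rho> * weight_sum_max n \<Lambda>) = 2 * (c2 / q)"
        by (simp add: c2_def kappa_star_def q_def)
      moreover have "0 \<le> c2 / q" using c2 q by simp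
      ultimately show ?thesis by linarith
    qed
    then have "ennreal (c2 / q) \<le> ennreal (1 / real n * (kappa_star \<rho> * weight_sum_max n \<Lambda>))"
      by (rule ennreal_leI)
    also have "\<dots> = ennreal (1 / real n) * (ennreal (kappa_star \<rho>) * ennreal (weight_sum_max n \<Lambda>))"
      using ks w by (simp only: ennreal_mult zero_le_divide_1_iff of_nat_0_le_iff mult_nonneg_nonneg)
    finally have 2: "ennreal (c2 / q) * mean_abs_error M V W
       \<le> ennreal (1 / real n) * (ennreal (kappa_star \<rho>) * ennreal (weight_sum_max n \<Lambda>)) * mean_abs_error M V W"
      by (rule mult_right_mono) simp
    show ?thesis
      unfolding B_term_def distrib_left add.assoc using 1 2
      by (intro add_mono order_refl) (simp_all only: mult.assoc)
  qed
  finally show ?thesis unfolding W_def .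
qed

end

theorem theorem2p1:
  fixes M :: "'a measure"
    and n :: nat
    and S :: "real \<Rightarrow> real"
    and \<sigma> :: "(real \<Rightarrow> real) \<Rightarrow> nat \<Rightarrow> 'a \<Rightarrow> real"
    and \<xi> :: "nat \<Rightarrow> 'a \<Rightarrow> real"
    and \<xi>star \<sigma>star \<rho> :: real
    and \<Lambda> :: "(nat \<Rightarrow> real) set"
  assumes model: "heteroscedastic_regression M n S \<sigma> \<xi> \<xi>star \<sigma>star"
    and n: "n \<ge> 3" "odd n"
    and \<rho>: "0 < \<rho>" "\<rho> < 1 / 3"
    and \<Lambda>: "\<Lambda> \<subseteq> {1..n} \<rightarrow>\<^sub>E {0..1}" "finite \<Lambda>" "\<Lambda> \<noteq> {}"
  shows "(\<forall>V lhat.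
            V \<in> borel_measurable M \<longrightarrow>
            cost_minimizer M n \<rho> \<Lambda> (observation n S \<sigma> \<xi>) V lhat \<longrightarrow>
            risk M n S (observation n S \<sigma> \<xi>) lhat
              \<le> ennreal (1 + kappa \<rho>)
                  * (MIN lam\<in>\<Lambda>. risk M n S (observation n S \<sigma> \<xi>) (\<lambda>_. lam))
                + ennreal (1 / real n) * B_term M n \<Lambda> \<xi>star \<sigma>star \<rho> V (mean_vol n S \<sigma>))
       \<and> (\<forall>lhat.
            cost_minimizer M n \<rho> \<Lambda> (observation n S \<sigma> \<xi>) (mean_vol n S \<sigma>) lhat \<longrightarrow>
            risk M n S (observation n S \<sigma> \<xi>) lhat
              \<le> ennreal (1 + kappa \<rho>)
                  * (MIN lam\<in>\<Lambda>. risk M n S (observation n S \<sigma> \<xi>) (\<lambda>_. lam))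
                + ennreal (1 / real n) * ennreal (Psi n \<Lambda> \<xi>star \<sigma>star \<rho>))"
proof -
  interpret heteroscedastic_regression M n S \<sigma> \<xi> \<xi>star \<sigma>star by (fact model)
  have "(MIN lam\<in>\<Lambda>. risk M n S (observation n S \<sigma> \<xi>) (\<lambda>_. lam))
      \<in> (\<lambda>lam. risk M n S (observation n S \<sigma> \<xi>) (\<lambda>_. lam)) ` \<Lambda>"
    using \<Lambda> by (intro Min_in) auto
  then obtain lam0 where lam0: "lam0 \<in> \<Lambda>"
    "(MIN lam\<in>\<Lambda>. risk M n S (observation n S \<sigma> \<xi>) (\<lambda>_. lam)) = risk M n S (observation n S \<sigma> \<xi>) (\<lambda>_. lam0)"
    by auto
  note ineq = oracle_inequality[OF n(2) \<rho> \<Lambda>(1,2) lam0(1), folded lam0(2)]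
  have "mean_vol n S \<sigma> \<in> borel_measurable M"
    using vol_measurable unfolding mean_vol_def
    by (auto intro!: borel_measurable_times borel_measurable_sum borel_measurable_power)
  \<comment> \<open>Known volatilities are the case \<open>V = mean_vol n S \<sigma>\<close>, in
    which \<open>B_term\<close> reduces to \<open>Psi\<close>.\<close>
  moreover have "mean_abs_error M (mean_vol n S \<sigma>) (mean_vol n S \<sigma>) = 0"
    by (simp add: mean_abs_error_def)
  ultimately show ?thesis
    using ineq ineq[of "mean_vol n S \<sigma>"] by (auto simp: B_term_def)
qed

end
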